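(* Let $\mathcal S$ be an operator system with unit $e$ and fix $k\in\mathbb N$. Then for every $n\in\mathbb N$, ${}^dQ_n^{k\text{-}min}(\mathcal S')=C_n^{k\text{-}min}(\mathcal S)$ and $(C_n^{k\text{-}max}(\mathcal S))^d=Q_n^{k\text{-}max}(\mathcal S')$.
   Context: $\mathcal S$ carries its natural matrix cones $M_n(\mathcal S)^+$. $\mathcal S'$ is the space of linear functionals on $\mathcal S$ continuous for the order norm. A matrix $(f_{ij})\in M_n(\mathcal S')$ is identified with the linear functional $F:M_n(\mathcal S)\to\mathbb C$, $F((v_{ij}))=\sum_{i,j}f_{ij}(v_{ij})$; it is also identified with the linear map $\mathcal S\to M_n$, $a\mapsto (f_{ij}(a))$. For a linear map $\phi$, $\phi^{(n)}((v_{ij}))=(\phi(v_{ij}))$; $\phi$ is $k$-positive if $\phi^{(k)}$ maps positive elements to positive elements, and $CP(\mathcal S,M_k)$ is the set of completely positive maps $\mathcal S\to M_k$. Let $S_k(\mathcal S)$ be the set of unital $k$-positive linear maps $\mathcal S\to M_k$ and $C_n^{k\text{-}min}(\mathcal S)=\{(a_{ij})\in M_n(\mathcal S):(\phi(a_{ij}))\ge0\text{ for all }\phi\in S_k(\mathcal S)\}$. Let $D_n^{k\text{-}max}(\mathcal S)=\{ADA^*:A\in M_{n,mk},\ D=\mathrm{diag}(D_1,\dots,D_m),\ D_l\in M_k(\mathcal S)^+,\ m\in\mathbb N\}$ and $C_n^{k\text{-}max}(\mathcal S)=\{A\in M_n(\mathcal S): r(e\otimes I_n)+A\in D_n^{k\text{-}max}(\mathcal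 S)\text{ for all }r>0\}$. For $G\in M_r(\mathcal S')$ and a scalar matrix $X\in M_{r,n}$, $X^*GX\in M_n(\mathcal S')$ is the usual matrix product and $F_{X^*GX}((v_{ij}))=\sum_{i,j}(X^*GX)_{ij}(v_{ij})$. Define $Q_n^{k\text{-}min}(\mathcal S')=\{F_{X^*GX}: X\in M_{mk,n},\ G=\mathrm{diag}(\phi_1,\dots,\phi_m),\ \phi_i\in CP(\mathcal S,M_k),\ m\in\mathbb N\}$, and $Q_n^{k\text{-}max}(\mathcal S')=\{(f_{ij})\in M_n(\mathcal S'): (f_{ij}^{(k)}(a))\in M_{nk}^+\text{ for all }a\in M_k(\mathcal S)^+\}$, where $(f_{ij}^{(k)}(a))$ is the $n\times n$ block matrix with blocks $f_{ij}^{(k)}(a)\in M_k$. For a cone $P_n\subseteq M_n(\mathcal S)$, its dual is $P_n^d=\{f:M_n(\mathcal S)\to\mathbb C \text{ linear}: f(P_n)\subseteq[0,\infty)\}$, regarded inside $M_n(\mathcal S')$ through the identification above with $f_{ij}(v)=f(E_{ij}\otimes v)$. For $Q_n\subseteq M_n(\mathcal S')$, ${}^dQ_n=\{v\in M_n(\mathcal S): f(v)\ge0\text{ for all }f\in Q_n\}$. *)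

theory Defs
  imports
    "Jordan_Normal_Form.Schur_Decomposition"
    "HOL-Library.Function_Algebras"
begin

text \<open>
  A matrix over an operator system, over its dual, or over the complex numbers is a
  matrix in the sense of \<^theory>\<open>Jordan_Normal_Form.Matrix\<close>, with entries indexed from 0.
  \<^theory>\<open>HOL-Library.Function_Algebras\<close> supplies the pointwise zero and sum for functionals,
  and the order on complex numbers is that of \<^theory>\<open>HOL-Library.Complex_Order\<close>:
  \<^term>\<open>0 \<le> (z::complex)\<close> says that \<^term>\<open>z\<close> is real and nonnegative.
\<close>

definition psd_mat :: "nat \<Rightarrow> complex mat \<Rightarrow> bool" where
  "psd_mat n A \<longleftrightarrow> A \<in> carrier_mat n n \<and> (\<forall>x\<in>carrier_vec n. 0 \<le> (A *\<^sub>v x) \<bullet>c x)"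

text \<open>The product \<open>A D B\<close> of a matrix \<open>D\<close> over a complex vector space, whose scalar
  multiplication is \<open>sc\<close>, with scalar matrices \<open>A\<close> and \<open>B\<close>.\<close>

definition bimod_prod ::
  "(complex \<Rightarrow> 'b \<Rightarrow> 'b) \<Rightarrow> complex mat \<Rightarrow> 'b::comm_monoid_add mat \<Rightarrow> complex mat \<Rightarrow> 'b mat" where
  "bimod_prod sc A D B = mat (dim_row A) (dim_col B)
     (\<lambda>(i,j). \<Sum>p<dim_col A. \<Sum>q<dim_row B. sc (A $$ (i,p) * B $$ (q,j)) (D $$ (p,q)))"

definition block_matrix :: "nat \<Rightarrow> nat \<Rightarrow> (nat \<Rightarrow> nat \<Rightarrow> complex mat) \<Rightarrow> complex mat" where
  "block_matrix n k B = mat (n * k) (n * k) (\<lambda>(r,c). B (r div k) (c div k) $$ (r mod k, c mod k))"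


section \<open>Abstract operator systems\<close>

record 'a opsys =
  os_scale :: "complex \<Rightarrow> 'a \<Rightarrow> 'a"
  os_star :: "'a \<Rightarrow> 'a"
  os_cone :: "nat \<Rightarrow> 'a mat set"
  os_unit :: 'a

definition star_mat :: "('a, 'm) opsys_scheme \<Rightarrow> 'a mat \<Rightarrow> 'a mat" where
  "star_mat S A = mat (dim_col A) (dim_row A) (\<lambda>(i,j). os_star S (A $$ (j,i)))"

definition herm_mats :: "('a, 'm) opsys_scheme \<Rightarrow> nat \<Rightarrow> 'a mat set" where
  "herm_mats S n = {A \<in> carrier_mat n n. star_mat S A = A}"

definition unit_diag :: "('a::zero, 'm) opsys_scheme \<Rightarrow> nat \<Rightarrow> 'a mat" where
  "unit_diag S n = mat n n (\<lambda>(i,j). if i = j then os_unit S else 0)"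

definition scale_mat :: "('a, 'm) opsys_scheme \<Rightarrow> complex \<Rightarrow> 'a mat \<Rightarrow> 'a mat" where
  "scale_mat S c A = map_mat (os_scale S c) A"

text \<open>The Choi--Effros axioms: a complex vector space with a conjugate linear involution and
  a matrix ordering, for which the unit is an Archimedean matrix order unit. The cones are
  only constrained in sizes \<open>n \<ge> 1\<close>; \<open>os_cone S n\<close> is the cone of positive elements
  of \<open>M\<^sub>n(S)\<close>.\<close>

locale operator_system = vector_space "os_scale S"
  for S :: "('a::ab_group_add, 'm) opsys_scheme" +
  assumes star_star: "os_star S (os_star S v) = v"
    and star_add: "os_star S (u + v) = os_star S u + os_star S v"
    and star_scale: "os_star S (os_scale S c v) = os_scale S (cnj c) (os_star S v)"
    and star_unit: "os_star S (os_unit S) = os_unit S"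
    and cone_herm: "n \<ge> 1 \<Longrightarrow> os_cone S n \<subseteq> herm_mats S n"
    and cone_zero: "n \<ge> 1 \<Longrightarrow> 0\<^sub>m n n \<in> os_cone S n"
    and cone_add: "n \<ge> 1 \<Longrightarrow> A \<in> os_cone S n \<Longrightarrow> B \<in> os_cone S n \<Longrightarrow> A + B \<in> os_cone S n"
    and cone_scale:
      "n \<ge> 1 \<Longrightarrow> A \<in> os_cone S n \<Longrightarrow> 0 \<le> (t::real) \<Longrightarrow> scale_mat S (of_real t) A \<in> os_cone S n"
    and cone_proper: "n \<ge> 1 \<Longrightarrow> A \<in> os_cone S n \<Longrightarrow> - A \<in> os_cone S n \<Longrightarrow> A = 0\<^sub>m n n"
    and cone_congruence:
      "n \<ge> 1 \<Longrightarrow> m \<ge> 1 \<Longrightarrow> A \<in> os_cone S n \<Longrightarrow> X \<in> carrier_mat n m \<Longrightarrow>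
        bimod_prod (os_scale S) (mat_adjoint X) A X \<in> os_cone S m"
    and order_unit:
      "n \<ge> 1 \<Longrightarrow> A \<in> herm_mats S n \<Longrightarrow>
        \<exists>r>0::real. scale_mat S (of_real r) (unit_diag S n) + A \<in> os_cone S n"
    and archimedean:
      "n \<ge> 1 \<Longrightarrow> A \<in> carrier_mat n n \<Longrightarrow>
        (\<And>r::real. r > 0 \<Longrightarrow> scale_mat S (of_real r) (unit_diag S n) + A \<in> os_cone S n) \<Longrightarrow>
        A \<in> os_cone S n"

text \<open>The order norm, extended to all elements as the norm of the operator system: the norm
  of \<open>v\<close> is at most \<open>r\<close> iff the \<open>2 \<times> 2\<close> matrix with diagonal entries \<open>r e\<close> and off-diagonal
  entries \<open>v\<close>, \<open>v\<^sup>*\<close> is positive. On selfadjoint elements this is the usual infimum of the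
  \<open>r\<close> with \<open>- r e \<le> v \<le> r e\<close>, as \<open>order_norm_selfadjoint\<close> below shows.\<close>

definition order_norm :: "('a, 'm) opsys_scheme \<Rightarrow> 'a \<Rightarrow> real" where
  "order_norm S v = Inf {r. 0 \<le> r \<and>
     mat 2 2 (\<lambda>(i,j). if i = j then os_scale S (of_real r) (os_unit S)
                      else if i = 0 then v else os_star S v) \<in> os_cone S 2}"

lemma (in operator_system) order_norm_selfadjoint:
  assumes h: "os_star S h = h"
  shows "order_norm S h = Inf {r. 0 \<le> r \<and>
     mat 1 1 (\<lambda>_. os_scale S (of_real r) (os_unit S) + h) \<in> os_cone S 1 \<and>
     mat 1 1 (\<lambda>_. os_scale S (of_real r) (os_unit S) - h) \<in> os_cone S 1}"
proof -
  define M where "M a b = mat 2 2 (\<lambda>(i,j). if i = j then a else (b::'a))" for a b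
  define X where "X s = mat 1 2 (\<lambda>(i,j::nat). if j = 0 then 1 else (s::complex))" for s
  define Y where "Y s = mat 2 1 (\<lambda>(i::nat,j::nat). if i = 0 then 1 else (s::complex))" for s
  have adjX: "mat_adjoint (X s) = Y (cnj s)" and adjY: "mat_adjoint (Y s) = X (cnj s)" for s
    by (auto simp: mat_adjoint_def X_def Y_def mat_of_rows_def)
  have [simp]: "dim_row (X s) = 1" "dim_col (X s) = 2" "dim_row (Y s) = 2" "dim_col (Y s) = 1"
    "dim_row (M a b) = 2" "dim_col (M a b) = 2" for a b s by (simp_all add: X_def Y_def M_def)
  have [simp]: "X s $$ (0,0) = 1" "X s $$ (0,1) = s" "Y s $$ (0,0) = 1" "Y s $$ (1,0) = s"
    "M a b $$ (0,0) = a" "M a b $$ (0,1) = b" "M a b $$ (1,0) = b" "M a b $$ (1,1) = a" for a b s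
    by (simp_all add: X_def Y_def M_def)
  have sum2: "sum f {..<2::nat} = f 0 + f 1" for f :: "nat \<Rightarrow> 'a"
    by (simp add: numeral_2_eq_2)
  have sum1: "sum f {..<1::nat} = f 0" for f :: "nat \<Rightarrow> 'a" by simp
  have s2: "os_scale S (1/2) (b + b) = b" for b
    using scale_right_distrib[of "1/2" b b] scale_left_distrib[of "1/2" "1/2" b] by simp
  have to1: "mat 1 1 (\<lambda>_. a + os_scale S s b) \<in> os_cone S 1"
    if M: "M a b \<in> os_cone S 2" and s: "s = 1 \<or> s = -1" for a b s
  proof -
    have "bimod_prod (os_scale S) (mat_adjoint (Y s)) (M a b) (Y s) \<in> os_cone S 1"
      by (rule cone_congruence[OF _ _ M]) (auto simp: Y_def)
    moreover have "bimod_prod (os_scale S) (mat_adjoint (Y s)) (M a b) (Y s)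
        = mat 1 1 (\<lambda>_. (a + os_scale S s b) + (a + os_scale S s b))"
      using s by (intro eq_matI) (auto simp: adjY bimod_prod_def sum2 algebra_simps simp del: One_nat_def)
    ultimately have "scale_mat S (of_real (1/2)) (mat 1 1 (\<lambda>_. (a + os_scale S s b) + (a + os_scale S s b)))
        \<in> os_cone S 1" using cone_scale[of 1 _ "1/2"] by auto
    moreover have "scale_mat S (of_real (1/2)) (mat 1 1 (\<lambda>_. (a + os_scale S s b) + (a + os_scale S s b)))
        = mat 1 1 (\<lambda>_. a + os_scale S s b)"
      using s2[of "a + os_scale S s b"] by (auto simp: scale_mat_def)
    ultimately show ?thesis by simp
  qed
  have to2: "M a b \<in> os_cone S 2"
    if p: "mat 1 1 (\<lambda>_. a + b) \<in> os_cone S 1" and m: "mat 1 1 (\<lambda>_. a - b) \<in> os_cone S 1" for a b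
  proof -
    define P where "P s c = bimod_prod (os_scale S) (mat_adjoint (X s)) (mat 1 1 (\<lambda>_. c)) (X s)" for s c
    have "P 1 (a + b) + P (-1) (a - b) \<in> os_cone S 2"
      unfolding P_def by (intro cone_add cone_congruence[of 1 2] p m) (auto simp: X_def)
    then have "scale_mat S (of_real (1/2)) (P 1 (a + b) + P (-1) (a - b)) \<in> os_cone S 2"
      using cone_scale[of 2 _ "1/2"] by auto
    moreover have "scale_mat S (of_real (1/2)) (P 1 (a + b) + P (-1) (a - b)) = M a b"
    proof (rule eq_matI)
      fix i j assume "i < dim_row (M a b)" "j < dim_col (M a b)"
      then have "i < 2" "j < 2" by (auto simp: M_def)
      moreover have "a + b + (a - b) = a + a" "a + b + (b - a) = b + b" by (simp_all add: algebra_simps)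
      ultimately show "scale_mat S (of_real (1/2)) (P 1 (a + b) + P (-1) (a - b)) $$ (i,j) = M a b $$ (i,j)"
        using s2[of a] s2[of b]
        by (auto simp: scale_mat_def P_def adjX bimod_prod_def sum1 less_2_cases_iff simp flip: One_nat_def)
    qed (auto simp: scale_mat_def P_def adjX bimod_prod_def)
    ultimately show ?thesis by simp
  qed
  have "M a h = mat 2 2 (\<lambda>(i,j). if i = j then a else if i = 0 then h else os_star S h)" for a
    by (auto simp: M_def h)
  moreover have "M a h \<in> os_cone S 2 \<longleftrightarrow>
      mat 1 1 (\<lambda>_. a + h) \<in> os_cone S 1 \<and> mat 1 1 (\<lambda>_. a - h) \<in> os_cone S 1" for a
    using to1[of a h 1] to1[of a h "-1"] to2[of a h] by auto
  ultimately show ?thesis unfolding order_norm_def by simp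
qed


section \<open>The dual space and positivity of maps\<close>

definition dual_space :: "('a::ab_group_add, 'm) opsys_scheme \<Rightarrow> ('a \<Rightarrow> complex) set" where
  "dual_space S = {f. Vector_Spaces.linear (os_scale S) (*) f \<and>
     (\<forall>u. \<forall>\<epsilon>>0. \<exists>\<delta>>0. \<forall>v. order_norm S (v - u) < \<delta> \<longrightarrow> cmod (f v - f u) < \<epsilon>)}"

definition dual_mats :: "('a::ab_group_add, 'm) opsys_scheme \<Rightarrow> nat \<Rightarrow> ('a \<Rightarrow> complex) mat set" where
  "dual_mats S n = {F \<in> carrier_mat n n. \<forall>i<n. \<forall>j<n. F $$ (i,j) \<in> dual_space S}"

definition dual_scale :: "complex \<Rightarrow> ('a \<Rightarrow> complex) \<Rightarrow> 'a \<Rightarrow> complex" where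
  "dual_scale c f = (\<lambda>v. c * f v)"

text \<open>The value at \<open>(v\<^sub>i\<^sub>j)\<close> of the functional identified with a matrix \<open>(f\<^sub>i\<^sub>j)\<close>.\<close>

definition pairing :: "nat \<Rightarrow> ('a \<Rightarrow> complex) mat \<Rightarrow> 'a mat \<Rightarrow> complex" where
  "pairing n F V = (\<Sum>i<n. \<Sum>j<n. (F $$ (i,j)) (V $$ (i,j)))"

definition matrix_map :: "('a::plus, 'm) opsys_scheme \<Rightarrow> nat \<Rightarrow> ('a \<Rightarrow> complex mat) \<Rightarrow> bool" where
  "matrix_map S k \<phi> \<longleftrightarrow> (\<forall>v. \<phi> v \<in> carrier_mat k k) \<and>
     (\<forall>u v. \<phi> (u + v) = \<phi> u + \<phi> v) \<and> (\<forall>c v. \<phi> (os_scale S c v) = c \<cdot>\<^sub>m \<phi> v)"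

text \<open>The matrix of functionals identified with a map into \<open>M\<^sub>k\<close>.\<close>

definition mat_of_map :: "nat \<Rightarrow> ('a \<Rightarrow> complex mat) \<Rightarrow> ('a \<Rightarrow> complex) mat" where
  "mat_of_map k \<phi> = mat k k (\<lambda>(i,j). \<lambda>a. \<phi> a $$ (i,j))"

definition amplify :: "nat \<Rightarrow> nat \<Rightarrow> ('a \<Rightarrow> complex mat) \<Rightarrow> 'a mat \<Rightarrow> complex mat" where
  "amplify n k \<phi> V = block_matrix n k (\<lambda>i j. \<phi> (V $$ (i,j)))"

definition positive_of_order ::
  "('a, 'm) opsys_scheme \<Rightarrow> nat \<Rightarrow> nat \<Rightarrow> ('a \<Rightarrow> complex mat) \<Rightarrow> bool" where
  "positive_of_order S n k \<phi> \<longleftrightarrow> (\<forall>V\<in>os_cone S n. psd_mat (n * k) (amplify n k \<phi> V))"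

definition CP_maps :: "('a::plus, 'm) opsys_scheme \<Rightarrow> nat \<Rightarrow> ('a \<Rightarrow> complex mat) set" where
  "CP_maps S k = {\<phi>. matrix_map S k \<phi> \<and> (\<forall>n\<ge>1. positive_of_order S n k \<phi>)}"

definition unital_kpos_maps :: "('a::plus, 'm) opsys_scheme \<Rightarrow> nat \<Rightarrow> ('a \<Rightarrow> complex mat) set" where
  "unital_kpos_maps S k =
     {\<phi>. matrix_map S k \<phi> \<and> \<phi> (os_unit S) = 1\<^sub>m k \<and> positive_of_order S k k \<phi>}"


section \<open>The cones\<close>

definition C_kmin :: "('a::plus, 'm) opsys_scheme \<Rightarrow> nat \<Rightarrow> nat \<Rightarrow> 'a mat set" where
  "C_kmin S k n =
     {A \<in> carrier_mat n n. \<forall>\<phi>\<in>unital_kpos_maps S k. psd_mat (n * k) (amplify n k \<phi> A)}"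

definition D_kmax :: "('a::ab_group_add, 'm) opsys_scheme \<Rightarrow> nat \<Rightarrow> nat \<Rightarrow> 'a mat set" where
  "D_kmax S k n =
     {bimod_prod (os_scale S) A (diag_block_mat Ds) (mat_adjoint A) | A Ds m.
        m \<ge> 1 \<and> A \<in> carrier_mat n (m * k) \<and> length Ds = m \<and> set Ds \<subseteq> os_cone S k}"

definition C_kmax :: "('a::ab_group_add, 'm) opsys_scheme \<Rightarrow> nat \<Rightarrow> nat \<Rightarrow> 'a mat set" where
  "C_kmax S k n = {A \<in> carrier_mat n n.
     \<forall>r>0::real. scale_mat S (of_real r) (unit_diag S n) + A \<in> D_kmax S k n}"

definition Q_kmin :: "('a::ab_group_add, 'm) opsys_scheme \<Rightarrow> nat \<Rightarrow> nat \<Rightarrow> ('a \<Rightarrow> complex) mat set" where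
  "Q_kmin S k n =
     {bimod_prod dual_scale (mat_adjoint X) (diag_block_mat (map (mat_of_map k) \<phi>s)) X | X \<phi>s m.
        m \<ge> 1 \<and> X \<in> carrier_mat (m * k) n \<and> length \<phi>s = m \<and> set \<phi>s \<subseteq> CP_maps S k}"

definition Q_kmax :: "('a::ab_group_add, 'm) opsys_scheme \<Rightarrow> nat \<Rightarrow> nat \<Rightarrow> ('a \<Rightarrow> complex) mat set" where
  "Q_kmax S k n = {F \<in> dual_mats S n. \<forall>V\<in>os_cone S k.
     psd_mat (n * k) (block_matrix n k (\<lambda>i j. map_mat (F $$ (i,j)) V))}"


section \<open>Duals of cones\<close>

definition elem_tensor :: "nat \<Rightarrow> nat \<Rightarrow> nat \<Rightarrow> 'a::zero \<Rightarrow> 'a mat" where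
  "elem_tensor n i j v = mat n n (\<lambda>(p,q). if p = i \<and> q = j then v else 0)"

definition linear_on_mats :: "('a::plus, 'm) opsys_scheme \<Rightarrow> nat \<Rightarrow> ('a mat \<Rightarrow> complex) \<Rightarrow> bool" where
  "linear_on_mats S n f \<longleftrightarrow>
     (\<forall>A\<in>carrier_mat n n. \<forall>B\<in>carrier_mat n n. f (A + B) = f A + f B) \<and>
     (\<forall>c. \<forall>A\<in>carrier_mat n n. f (scale_mat S c A) = c * f A)"

text \<open>The dual of a cone \<open>P \<subseteq> M\<^sub>n(S)\<close>. Its members are all positive linear functionals on
  \<open>M\<^sub>n(S)\<close>, without a continuity requirement, each replaced by its matrix of functionals.\<close>

definition dual_cone :: "('a::ab_group_add, 'm) opsys_scheme \<Rightarrow> nat \<Rightarrow> 'a mat set \<Rightarrow> ('a \<Rightarrow> complex) mat set" where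
  "dual_cone S n P =
     {mat n n (\<lambda>(i,j). \<lambda>v. f (elem_tensor n i j v)) | f.
        linear_on_mats S n f \<and> (\<forall>A\<in>P. 0 \<le> f A)}"

definition predual_cone :: "nat \<Rightarrow> ('a \<Rightarrow> complex) mat set \<Rightarrow> 'a mat set" where
  "predual_cone n Q = {V \<in> carrier_mat n n. \<forall>F\<in>Q. 0 \<le> pairing n F V}"

end

theory Submission
  imports Defs
begin

text \<open>Both equalities say that two families of test functionals agree on positivity, and
  both rest on one computation. A quadratic form of a matrix of blocks \<open>f\<^sub>p\<^sub>q(v\<^sub>i\<^sub>j)\<close> at a
  vector \<open>x\<close> is a sum \<open>\<Sum> cnj(x\<^sub>i\<^sub>p) f\<^sub>p\<^sub>q(v\<^sub>i\<^sub>j) x\<^sub>j\<^sub>q\<close>. The scalars can be absorbed on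
  either side: into the functionals, which gives \<open>X\<^sup>* F X\<close>, or into the elements, which
  gives a compression \<open>X\<^sup>* V X\<close>, and compressions preserve positivity.

  For the minimal cone, the functionals in \<open>Q_kmin\<close> evaluate at \<open>A\<close> to sums of quadratic
  forms of \<open>\<phi>\<^sub>l(A)\<close> with \<open>\<phi>\<^sub>l\<close> completely positive (\<open>pairing_Q_kmin\<close>), whereas \<open>C_kmin\<close> asks
  for positivity of \<open>\<phi>(A)\<close> with \<open>\<phi>\<close> unital and \<open>k\<close>-positive. A \<open>k\<close>-positive map into \<open>M\<^sub>k\<close>
  is completely positive, because a quadratic form of an amplification of any size is the
  value of one fixed functional at a compression of size \<open>k\<close> (\<open>kpos_imp_CP\<close>). Conversely,
  let \<open>\<phi>\<close> be completely positive and \<open>s\<close> a state. For \<open>r > 0\<close> the map \<open>\<phi> + r s(\<cdot>) I\<close> has a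
  positive definite value at the unit, so that it is a congruence of a unital \<open>k\<close>-positive
  map; letting \<open>r \<rightarrow> 0\<close> shows that \<open>\<phi>(A)\<close> is positive for \<open>A\<close> in \<open>C_kmin\<close>
  (\<open>C_kmin_CP_nonneg\<close>). If there is no state, there is no nonzero completely positive map
  either.

  For the maximal cone, a matrix of functionals evaluates at \<open>A D A\<^sup>*\<close>, where \<open>D\<close> has
  diagonal blocks \<open>D\<^sub>l\<close>, to a sum of quadratic forms of the block matrices \<open>(f\<^sub>i\<^sub>j(D\<^sub>l))\<close>
  (\<open>pairing_D_kmax\<close>), and every quadratic form arises in this way. Hence positivity on
  \<open>D_kmax\<close>, positivity on its closure \<open>C_kmax\<close>, and the defining condition of \<open>Q_kmax\<close> are
  the same. What remains is that the entries \<open>f\<^sub>i\<^sub>j\<close> are continuous for the order norm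
  although the dual of a cone imposes no continuity. A positive functional on \<open>S\<close> is bounded
  by its value at the unit, and by polarization each entry is a combination of four positive
  functionals (\<open>matrix_of_functionals_dual_space\<close>).\<close>

section \<open>Quadratic forms of block matrices\<close>

lemma sum_mult_index:
  fixes g :: "nat \<Rightarrow> 'b::comm_monoid_add"
  shows "(\<Sum>r<n * k. g r) = (\<Sum>i<n. \<Sum>p<k. g (i * k + p))"
proof -
  have "(\<Sum>p<k. g (i * k + p)) = sum g {i * k..<i * k + k}" for i
    using sum.shift_bounds_nat_ivl[of g 0 "i * k" k] by (simp add: add.commute atLeast0LessThan)
  then show ?thesis by (simp add: sum.nat_group)
qed

lemma mult_index_less: "i < n \<Longrightarrow> p < k \<Longrightarrow> i * k + p < n * (k::nat)"
proof -
  assume i: "i < n" and p: "p < k"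
  have "i * k + p < (i + 1) * k" using p by simp
  also have "\<dots> \<le> n * k" using i by (intro mult_right_mono) auto
  finally show ?thesis .
qed

lemma sum_swap4:
  fixes f :: "nat \<Rightarrow> nat \<Rightarrow> nat \<Rightarrow> nat \<Rightarrow> 'b::comm_monoid_add"
  shows "(\<Sum>i\<in>A. \<Sum>j\<in>B. \<Sum>p\<in>C. \<Sum>q\<in>D. f i j p q) = (\<Sum>p\<in>C. \<Sum>q\<in>D. \<Sum>i\<in>A. \<Sum>j\<in>B. f i j p q)"
proof -
  have "(\<Sum>i\<in>A. \<Sum>j\<in>B. \<Sum>p\<in>C. \<Sum>q\<in>D. f i j p q) = (\<Sum>z\<in>A \<times> B. \<Sum>w\<in>C \<times> D. f (fst z) (snd z) (fst w) (snd w))"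
    by (simp only: sum.cartesian_product' fst_conv snd_conv)
  also have "\<dots> = (\<Sum>w\<in>C \<times> D. \<Sum>z\<in>A \<times> B. f (fst z) (snd z) (fst w) (snd w))"
    by (rule sum.swap)
  finally show ?thesis by (simp only: sum.cartesian_product' fst_conv snd_conv)
qed

lemma sum_if_const: "(\<Sum>q\<in>A. if P then g q else 0) = (if P then \<Sum>q\<in>A. g q else 0)"
  by simp

lemma fun_sum_apply: "(\<Sum>a\<in>A. h a) v = (\<Sum>a\<in>A. h a v :: complex)"
  by (induction A rule: infinite_finite_induct) auto

lemma adjoint_carrier [simp]: "X \<in> carrier_mat n m \<Longrightarrow> mat_adjoint X \<in> carrier_mat m n"
  by (auto simp: mat_adjoint_def)

lemma adjoint_dim [simp]: "dim_row (mat_adjoint X) = dim_col X" "dim_col (mat_adjoint X) = dim_row X"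
  by (auto simp: mat_adjoint_def)

lemma adjoint_entry:
  fixes X :: "complex mat"
  shows "X \<in> carrier_mat n m \<Longrightarrow> i < m \<Longrightarrow> j < n \<Longrightarrow> mat_adjoint X $$ (i,j) = cnj (X $$ (j,i))"
  by (auto simp: mat_adjoint_def mat_of_rows_def)

lemma psd_mat_iff:
  "psd_mat N A \<longleftrightarrow> A \<in> carrier_mat N N \<and>
     (\<forall>x. 0 \<le> (\<Sum>i<N. \<Sum>j<N. cnj (x i) * A $$ (i,j) * x j))"
proof -
  have form: "(A *\<^sub>v v) \<bullet>c v = (\<Sum>i<N. \<Sum>j<N. cnj (v $ i) * A $$ (i,j) * v $ j)"
    if "A \<in> carrier_mat N N" "v \<in> carrier_vec N" for v
  proof -
    have "(A *\<^sub>v v) \<bullet>c v = (\<Sum>i<N. (\<Sum>j<N. A $$ (i,j) * v $ j) * cnj (v $ i))"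
      using that by (auto simp: scalar_prod_def atLeast0LessThan intro!: sum.cong)
    then show ?thesis by (simp add: sum_distrib_left mult.commute mult.left_commute)
  qed
  have "0 \<le> (\<Sum>i<N. \<Sum>j<N. cnj (x i) * A $$ (i,j) * x j)" if "psd_mat N A" for x
  proof -
    have "(\<Sum>i<N. \<Sum>j<N. cnj (x i) * A $$ (i,j) * x j) = (A *\<^sub>v vec N x) \<bullet>c vec N x"
      using that by (simp add: form psd_mat_def)
    then show ?thesis using that by (simp add: psd_mat_def)
  qed
  moreover have "psd_mat N A" if "A \<in> carrier_mat N N"
    "\<And>x. 0 \<le> (\<Sum>i<N. \<Sum>j<N. cnj (x i) * A $$ (i,j) * x j)"
    using that by (simp add: psd_mat_def form)
  ultimately show ?thesis by (auto simp: psd_mat_def)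
qed

text \<open>The value at the vector \<open>x\<close> of the quadratic form of an \<open>n \<times> n\<close> matrix of \<open>k \<times> k\<close>
  blocks; \<open>b i j p q\<close> is the entry \<open>(p,q)\<close> of the block \<open>(i,j)\<close>, and \<open>x i p\<close> is the
  coordinate with flat index \<open>i * k + p\<close>. With this encoding the two ways of reading a
  tensor in \<open>M\<^sub>n \<otimes> M\<^sub>k\<close> differ only in the order of summation.\<close>

definition block_form ::
  "nat \<Rightarrow> nat \<Rightarrow> (nat \<Rightarrow> nat \<Rightarrow> nat \<Rightarrow> nat \<Rightarrow> complex) \<Rightarrow> (nat \<Rightarrow> nat \<Rightarrow> complex) \<Rightarrow> complex" where
  "block_form n k b x = (\<Sum>i<n. \<Sum>j<n. \<Sum>p<k. \<Sum>q<k. cnj (x i p) * b i j p q * x j q)"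

lemma block_form_cong:
  assumes "\<And>i j p q. i < n \<Longrightarrow> j < n \<Longrightarrow> p < k \<Longrightarrow> q < k \<Longrightarrow> b i j p q = b' i j p q"
  shows "block_form n k b x = block_form n k b' x"
  unfolding block_form_def using assms by (intro sum.cong refl) auto

lemma block_form_add_scaled:
  "block_form n k (\<lambda>i j p q. b i j p q + c * b' i j p q) x = block_form n k b x + c * block_form n k b' x"
  by (simp add: block_form_def sum.distrib sum_distrib_left algebra_simps)

lemma psd_block_iff:
  "psd_mat (n * k) (block_matrix n k B) \<longleftrightarrow> (\<forall>x. 0 \<le> block_form n k (\<lambda>i j p q. B i j $$ (p,q)) x)"
proof -
  have form: "(\<Sum>r<n * k. \<Sum>c<n * k. cnj (x r) * block_matrix n k B $$ (r,c) * x c)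
      = block_form n k (\<lambda>i j p q. B i j $$ (p,q)) (\<lambda>i p. x (i * k + p))" for x
  proof -
    have "(\<Sum>r<n * k. \<Sum>c<n * k. cnj (x r) * block_matrix n k B $$ (r,c) * x c)
        = (\<Sum>i<n. \<Sum>p<k. \<Sum>j<n. \<Sum>q<k. cnj (x (i * k + p)) * B i j $$ (p,q) * x (j * k + q))"
      unfolding sum_mult_index by (intro sum.cong refl) (simp add: block_matrix_def mult_index_less)
    also have "\<dots> = (\<Sum>i<n. \<Sum>j<n. \<Sum>p<k. \<Sum>q<k. cnj (x (i * k + p)) * B i j $$ (p,q) * x (j * k + q))"
      by (intro sum.cong refl sum.swap)
    finally show ?thesis unfolding block_form_def .
  qed
  have onto: "block_form n k b x = block_form n k b (\<lambda>i p. x ((i * k + p) div k) ((i * k + p) mod k))" for b x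
    unfolding block_form_def by (intro sum.cong refl) auto
  have "block_matrix n k B \<in> carrier_mat (n * k) (n * k)" by (simp add: block_matrix_def)
  moreover have "0 \<le> block_form n k b x"
    if "\<forall>x. 0 \<le> block_form n k b (\<lambda>i p. x (i * k + p))" for b x
    by (subst onto) (rule that[rule_format, of "\<lambda>r. x (r div k) (r mod k)"])
  ultimately show ?thesis unfolding psd_mat_iff form by blast
qed

section \<open>Products with block diagonal matrices\<close>

lemma diag_block_entry:
  assumes "\<And>D. D \<in> set Ds \<Longrightarrow> D \<in> carrier_mat k k"
    and "l < length Ds" "l' < length Ds" "p < k" "q < k"
  shows "diag_block_mat Ds $$ (l * k + p, l' * k + q) = (if l = l' then Ds ! l $$ (p,q) else 0)"
  using assms
proof (induction Ds arbitrary: l l')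
  case (Cons D Ds)
  have dims: "sum_list (map dim_row Ds) = length Ds * k" "sum_list (map dim_col Ds) = length Ds * k"
  proof -
    have "map dim_row Ds = map (\<lambda>_. k) Ds" "map dim_col Ds = map (\<lambda>_. k) Ds"
      using Cons.prems(1) by (auto dest: carrier_matD)
    then show "sum_list (map dim_row Ds) = length Ds * k" "sum_list (map dim_col Ds) = length Ds * k"
      by (simp_all only: sum_list_triv of_nat_id)
  qed
  have D: "D \<in> carrier_mat k k" using Cons.prems by auto
  have entry: "diag_block_mat (D # Ds) $$ (r,c) = (if r < k then if c < k then D $$ (r,c) else 0
      else if c < k then 0 else diag_block_mat Ds $$ (r - k, c - k))"
    if "r < k + length Ds * k" "c < k + length Ds * k" for r c
    using that by (simp add: Let_def dim_diag_block_mat dims carrier_matD[OF D])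
  have IH: "diag_block_mat Ds $$ (a * k + p, b * k + q) = (if a = b then Ds ! a $$ (p,q) else 0)"
    if "a < length Ds" "b < length Ds" for a b
    using Cons.IH[OF Cons.prems(1)] that Cons.prems by auto
  have less: "l * k + p < k + length Ds * k" "l' * k + q < k + length Ds * k"
    using mult_index_less[of l "Suc (length Ds)" p k] mult_index_less[of l' "Suc (length Ds)" q k] Cons.prems
    by simp_all
  show ?case
    unfolding entry[OF less] using Cons.prems(2-5) IH by (cases l; cases l') simp_all
qed simp

lemma bimod_diag_entry:
  assumes X: "X \<in> carrier_mat n (m * k)" and Y: "Y \<in> carrier_mat (m * k) n'"
    and Ds: "length Ds = m" "\<And>D. D \<in> set Ds \<Longrightarrow> D \<in> carrier_mat k k"
    and sc0: "\<And>c. sc c 0 = 0" and ij: "i < n" "j < n'"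
  shows "bimod_prod sc X (diag_block_mat Ds) Y $$ (i,j)
    = (\<Sum>l<m. \<Sum>p<k. \<Sum>q<k. sc (X $$ (i, l * k + p) * Y $$ (l * k + q, j)) (Ds ! l $$ (p,q)))"
proof -
  have "bimod_prod sc X (diag_block_mat Ds) Y $$ (i,j)
      = (\<Sum>l<m. \<Sum>p<k. \<Sum>l'<m. \<Sum>q<k. sc (X $$ (i, l * k + p) * Y $$ (l' * k + q, j))
          (diag_block_mat Ds $$ (l * k + p, l' * k + q)))"
    using X Y ij by (simp add: bimod_prod_def sum_mult_index)
  also have "\<dots> = (\<Sum>l<m. \<Sum>p<k. \<Sum>l'<m. if l = l' then
        \<Sum>q<k. sc (X $$ (i, l * k + p) * Y $$ (l * k + q, j)) (Ds ! l $$ (p,q)) else 0)"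
    using Ds by (intro sum.cong refl) (auto simp: diag_block_entry sc0)
  finally show ?thesis by simp
qed

section \<open>Positive definite forms are congruent to the standard one\<close>

lemma triple_product_entry:
  fixes C M :: "complex mat"
  assumes C: "C \<in> carrier_mat k k" and M: "M \<in> carrier_mat k k" and pq: "p < k" "q < k"
  shows "(mat_adjoint C * M * C) $$ (p,q) = (\<Sum>s<k. \<Sum>t<k. cnj (C $$ (s,p)) * M $$ (s,t) * C $$ (t,q))"
proof -
  have "(mat_adjoint C * M * C) $$ (p,q) = (\<Sum>t<k. (\<Sum>s<k. cnj (C $$ (s,p)) * M $$ (s,t)) * C $$ (t,q))"
    using C M pq adjoint_dim[of C]
    by (auto simp: scalar_prod_def atLeast0LessThan adjoint_entry[OF C] intro!: sum.cong)
  also have "\<dots> = (\<Sum>s<k. \<Sum>t<k. cnj (C $$ (s,p)) * M $$ (s,t) * C $$ (t,q))"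
    unfolding sum_distrib_right by (rule sum.swap)
  finally show ?thesis .
qed

lemma block_form_congruence:
  fixes C :: "complex mat" and M :: "nat \<Rightarrow> nat \<Rightarrow> complex mat"
  assumes C: "C \<in> carrier_mat k k" and M: "\<And>i j. M i j \<in> carrier_mat k k"
  shows "block_form n k (\<lambda>i j p q. (mat_adjoint C * M i j * C) $$ (p,q)) x
    = block_form n k (\<lambda>i j p q. M i j $$ (p,q)) (\<lambda>i s. \<Sum>p<k. C $$ (s,p) * x i p)"
proof -
  have "(\<Sum>p<k. \<Sum>q<k. cnj (x i p) * (mat_adjoint C * M i j * C) $$ (p,q) * x j q)
      = (\<Sum>s<k. \<Sum>t<k. cnj (\<Sum>p<k. C $$ (s,p) * x i p) * M i j $$ (s,t) * (\<Sum>q<k. C $$ (t,q) * x j q))" for i j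
  proof -
    have "(\<Sum>p<k. \<Sum>q<k. cnj (x i p) * (mat_adjoint C * M i j * C) $$ (p,q) * x j q)
      = (\<Sum>p<k. \<Sum>q<k. \<Sum>s<k. \<Sum>t<k. cnj (C $$ (s,p) * x i p) * M i j $$ (s,t) * (C $$ (t,q) * x j q))"
      by (intro sum.cong refl)
        (simp add: triple_product_entry[OF C M] sum_distrib_left sum_distrib_right algebra_simps del: index_mult_mat)
    also have "\<dots> = (\<Sum>s<k. \<Sum>t<k. \<Sum>p<k. \<Sum>q<k. cnj (C $$ (s,p) * x i p) * M i j $$ (s,t) * (C $$ (t,q) * x j q))"
      by (rule sum_swap4)
    also have "\<dots> = (\<Sum>s<k. \<Sum>t<k. cnj (\<Sum>p<k. C $$ (s,p) * x i p) * M i j $$ (s,t) * (\<Sum>q<k. C $$ (t,q) * x j q))"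
      unfolding cnj_sum sum_distrib_right unfolding sum_distrib_left by (rule refl)
    finally show ?thesis .
  qed
  then show ?thesis unfolding block_form_def by simp
qed

definition sesq :: "nat \<Rightarrow> (nat \<Rightarrow> nat \<Rightarrow> complex) \<Rightarrow> (nat \<Rightarrow> complex) \<Rightarrow> (nat \<Rightarrow> complex) \<Rightarrow> complex" where
  "sesq k P u w = (\<Sum>p<k. \<Sum>q<k. cnj (u p) * P p q * w q)"

lemma sesq_add_left: "sesq k P (\<lambda>p. u p + v p) w = sesq k P u w + sesq k P v w"
  by (simp add: sesq_def sum.distrib algebra_simps)

lemma sesq_add_right: "sesq k P w (\<lambda>p. u p + v p) = sesq k P w u + sesq k P w v"
  by (simp add: sesq_def sum.distrib algebra_simps)

lemma sesq_scale_left: "sesq k P (\<lambda>p. c * u p) w = cnj c * sesq k P u w"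
  by (simp add: sesq_def sum_distrib_left ac_simps)

lemma sesq_scale_right: "sesq k P w (\<lambda>p. c * u p) = c * sesq k P w u"
  by (simp add: sesq_def sum_distrib_left ac_simps)

text \<open>A sesquilinear form that is real on the diagonal is Hermitian: the imaginary parts of
  the form at \<open>u + w\<close> and at \<open>u + \<i> w\<close> determine both parts of the difference.\<close>

lemma sesq_hermitian:
  assumes "\<And>u. sesq k P u u \<in> \<real>"
  shows "sesq k P w u = cnj (sesq k P u w)"
proof -
  have 1: "Im (sesq k P u w + sesq k P w u) = 0"
    using assms[of "\<lambda>p. u p + w p"] assms[of u] assms[of w]
    by (simp add: sesq_add_left sesq_add_right complex_is_Real_iff)
  have "Im (sesq k P (\<lambda>p. u p + \<i> * w p) (\<lambda>p. u p + \<i> * w p)) = 0"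
    using assms complex_is_Real_iff by blast
  then have 2: "Im (\<i> * sesq k P u w - \<i> * sesq k P w u) = 0"
    using assms[of u] assms[of w]
    by (simp add: sesq_add_left sesq_add_right sesq_scale_left sesq_scale_right complex_is_Real_iff)
  show ?thesis using 1 2 by (simp add: complex_eq_iff)
qed

text \<open>Gram--Schmidt by counting: fewer than \<open>k\<close> linear conditions on a vector of length \<open>k\<close>
  have a nonzero common solution, so an orthonormal system that is too short can always be
  extended.\<close>

lemma orthonormal_system:
  assumes pos: "\<And>u. (\<exists>p<k. u p \<noteq> 0) \<Longrightarrow> 0 < sesq k P u u"
    and m: "m \<le> k"
  shows "\<exists>v. \<forall>a<m. \<forall>b<m. sesq k P (v a) (v b) = (if a = b then 1 else 0)"
  using m
proof (induction m)
  case (Suc m)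
  then obtain v where v: "\<And>a b. a < m \<Longrightarrow> b < m \<Longrightarrow> sesq k P (v a) (v b) = (if a = b then 1 else 0)"
    by auto
  have herm: "sesq k P w u = cnj (sesq k P u w)" for u w
  proof (rule sesq_hermitian)
    fix u show "sesq k P u u \<in> \<real>"
    proof (cases "\<exists>p<k. u p \<noteq> 0")
      case True then show ?thesis using pos[OF True] by (simp add: complex_is_Real_iff less_complex_def)
    next
      case False then have "sesq k P u u = 0" unfolding sesq_def by (intro sum.neutral ballI) auto
      then show ?thesis by simp
    qed
  qed
  \<comment> \<open>Orthogonality to the first \<open>m\<close> vectors, padded by zero rows to a square and hence singular system.\<close>
  define A where "A = mat k k (\<lambda>(a,q). if a < m then \<Sum>p<k. cnj (v a p) * P p q else 0)"
  have A: "A \<in> carrier_mat k k" by (simp add: A_def)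
  have "det A = 0"
  proof -
    have "A = mat\<^sub>r k k (\<lambda>a. if a = m then 0\<^sub>v k else row A a)"
      by (rule eq_matI) (auto simp: A_def)
    moreover have "det (mat\<^sub>r k k (\<lambda>a. if a = m then 0\<^sub>v k else row A a)) = 0"
      using Suc.prems by (intro det_row_0) (auto simp: A_def)
    ultimately show ?thesis by metis
  qed
  then obtain y where y: "y \<in> carrier_vec k" "y \<noteq> 0\<^sub>v k" "A *\<^sub>v y = 0\<^sub>v k"
    using det_0_iff_vec_prod_zero_field[OF A] by blast
  let ?u = "\<lambda>p. y $ p"
  have orth: "sesq k P (v a) ?u = 0" if "a < m" for a
  proof -
    have "(A *\<^sub>v y) $ a = 0" using y that Suc.prems by simp
    moreover have "(A *\<^sub>v y) $ a = (\<Sum>q<k. (\<Sum>p<k. cnj (v a p) * P p q) * y $ q)"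
      using that Suc.prems carrier_vecD[OF y(1)] by (simp add: A_def scalar_prod_def atLeast0LessThan)
    moreover have "\<dots> = sesq k P (v a) ?u"
      unfolding sesq_def sum_distrib_right by (rule sum.swap)
    ultimately show ?thesis by simp
  qed
  have "\<exists>p<k. ?u p \<noteq> 0" using y by (auto simp: vec_eq_iff)
  then have up: "0 < sesq k P ?u ?u" by (rule pos)
  define t where "t = Re (sesq k P ?u ?u)"
  have t: "t > 0" "sesq k P ?u ?u = of_real t"
    using up by (auto simp: t_def less_complex_def complex_eq_iff)
  define c :: complex where "c = of_real (1 / sqrt t)"
  define w where "w = (\<lambda>p. c * y $ p)"
  have "sesq k P w w = of_real (1 / sqrt t * (1 / sqrt t) * t)"
    by (simp only: w_def sesq_scale_left sesq_scale_right t(2) c_def complex_cnj_complex_of_real of_real_mult mult.assoc)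
  also have "\<dots> = 1" using t by simp
  finally have ww: "sesq k P w w = 1" .
  have vw: "sesq k P (v a) w = 0" if "a < m" for a
    using orth[OF that] by (simp add: w_def sesq_scale_right)
  have wv: "sesq k P w (v a) = 0" if "a < m" for a
    using vw[OF that] herm[of w "v a"] by simp
  have "\<forall>a<Suc m. \<forall>b<Suc m. sesq k P ((v(m := w)) a) ((v(m := w)) b) = (if a = b then 1 else 0)"
    using v ww vw wv by (auto simp: less_Suc_eq)
  then show ?case by blast
qed simp

text \<open>The columns of \<open>B\<close> are an orthonormal basis for the form \<open>P\<close>. This takes the place of
  the inverse square root of \<open>P\<close>: normalising a map by a congruence only needs some \<open>B\<close> with
  this property and its inverse \<open>C\<close>.\<close>

lemma congruent_to_one:
  fixes P :: "complex mat"
  assumes P: "P \<in> carrier_mat k k"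
    and pos: "\<And>u. (\<exists>p<k. u p \<noteq> 0) \<Longrightarrow> 0 < sesq k (\<lambda>p q. P $$ (p,q)) u u"
  shows "\<exists>B C. B \<in> carrier_mat k k \<and> C \<in> carrier_mat k k \<and> mat_adjoint B * P * B = 1\<^sub>m k \<and> B * C = 1\<^sub>m k"
proof -
  obtain v where v: "\<And>a b. a < k \<Longrightarrow> b < k \<Longrightarrow> sesq k (\<lambda>p q. P $$ (p,q)) (v a) (v b) = (if a = b then 1 else 0)"
    using orthonormal_system[OF pos, of k] by auto
  define B where "B = mat k k (\<lambda>(p,a). v a p)"
  have B: "B \<in> carrier_mat k k" by (simp add: B_def)
  have eq: "mat_adjoint B * P * B = 1\<^sub>m k"
  proof (rule eq_matI)
    fix i j assume "i < dim_row (1\<^sub>m k)" "j < dim_col (1\<^sub>m k)"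
    then have ij: "i < k" "j < k" by auto
    have "(mat_adjoint B * P * B) $$ (i,j) = sesq k (\<lambda>p q. P $$ (p,q)) (v i) (v j)"
      unfolding triple_product_entry[OF B P ij] sesq_def using ij by (simp add: B_def)
    then show "(mat_adjoint B * P * B) $$ (i,j) = 1\<^sub>m k $$ (i,j)" using v ij by simp
  qed (use B in auto)
  have "mat_adjoint B * P \<in> carrier_mat k k" using B P by auto
  moreover have "B * (mat_adjoint B * P) = 1\<^sub>m k"
    using mat_mult_left_right_inverse[OF _ B eq] calculation by simp
  ultimately show ?thesis using B eq by blast
qed

text \<open>The form in which closedness of the positive half-line is used: it replaces the limit
  \<open>r \<rightarrow> 0\<close>, both when a map is perturbed to have invertible value at the unit and when a cone
  is defined by \<open>r e + A\<close>.\<close>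

lemma nonneg_if_perturbed_nonneg:
  fixes a b :: complex
  assumes "\<And>r::real. r > 0 \<Longrightarrow> 0 \<le> a + of_real r * b"
  shows "0 \<le> a"
proof -
  have im: "Im a + r * Im b = 0" and re: "0 \<le> Re a + r * Re b" if "r > 0" for r
    using assms[OF that] by (simp_all add: less_eq_complex_def)
  have "Im a = 0" using im[of 1] im[of 2] by simp
  moreover have "0 \<le> Re a"
  proof (rule field_le_epsilon)
    fix e :: real assume e: "e > 0"
    define r where "r = e / (\<bar>Re b\<bar> + 1)"
    have r: "r > 0" using e by (simp add: r_def)
    have "r * Re b \<le> r * (\<bar>Re b\<bar> + 1)" using r by (intro mult_left_mono) auto
    also have "\<dots> = e" using abs_ge_zero[of "Re b"] by (simp add: r_def add_nonneg_eq_0_iff)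
    finally show "0 \<le> Re a + e" using re[OF r] by linarith
  qed
  ultimately show ?thesis by (simp add: less_eq_complex_def)
qed

section \<open>Linear functionals and compressions\<close>

definition linear_functional :: "('a::ab_group_add, 'm) opsys_scheme \<Rightarrow> ('a \<Rightarrow> complex) \<Rightarrow> bool" where
  "linear_functional S f \<longleftrightarrow> (\<forall>u v. f (u + v) = f u + f v) \<and> (\<forall>c v. f (os_scale S c v) = c * f v)"

text \<open>The product \<open>X\<^sup>* V X\<close> for the scalar matrix \<open>X = (x p i)\<close>, with \<open>n\<close> rows and \<open>m\<close>
  columns.\<close>

definition compression ::
  "('a::ab_group_add, 'm) opsys_scheme \<Rightarrow> nat \<Rightarrow> nat \<Rightarrow> (nat \<Rightarrow> nat \<Rightarrow> complex) \<Rightarrow> 'a mat \<Rightarrow> 'a mat" where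
  "compression S n m x V =
     mat m m (\<lambda>(i,j). \<Sum>p<n. \<Sum>q<n. os_scale S (cnj (x p i) * x q j) (V $$ (p,q)))"

lemma linear_functionalD:
  assumes "linear_functional S f"
  shows "f (u + v) = f u + f v" "f (os_scale S c v) = c * f v" "f 0 = 0" "f (- v) = - f v" "f (u - v) = f u - f v"
proof -
  show add: "f (u + v) = f u + f v" for u v using assms by (simp add: linear_functional_def)
  show "f (os_scale S c v) = c * f v" using assms by (simp add: linear_functional_def)
  show 0: "f 0 = 0" using add[of 0 0] by simp
  show neg: "f (- v) = - f v" for v using add[of v "- v"] 0 by (simp add: eq_neg_iff_add_eq_0 add.commute)
  show "f (u - v) = f u - f v" using add[of u "- v"] neg[of v] by simp
qed

lemma linear_functional_sum: "linear_functional S f \<Longrightarrow> f (\<Sum>p\<in>A. g p) = (\<Sum>p\<in>A. f (g p))"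
  by (induction A rule: infinite_finite_induct) (auto simp: linear_functionalD)

lemma matrix_map_linear_functional:
  assumes "matrix_map S k \<phi>" "p < k" "q < k"
  shows "linear_functional S (\<lambda>v. \<phi> v $$ (p,q))"
  using assms unfolding matrix_map_def linear_functional_def by (metis carrier_matD index_add_mat(1) index_smult_mat(1))

context operator_system
begin

lemma linear_iff_linear_functional: "Vector_Spaces.linear (os_scale S) (*) f \<longleftrightarrow> linear_functional S f"
proof -
  have "vector_space ((*) :: complex \<Rightarrow> complex \<Rightarrow> complex)"
    by unfold_locales (auto simp: algebra_simps)
  then show ?thesis using vector_space_axioms by (simp add: Vector_Spaces.linear_iff linear_functional_def)
qed

lemma compression_cone:
  assumes "n \<ge> 1" "m \<ge> 1" "V \<in> os_cone S n"
  shows "compression S n m x V \<in> os_cone S m"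
proof -
  define X where "X = mat n m (\<lambda>(p,i). x p i)"
  have X: "X \<in> carrier_mat n m" by (simp add: X_def)
  have "bimod_prod (os_scale S) (mat_adjoint X) V X = compression S n m x V"
    by (rule eq_matI) (auto simp: bimod_prod_def compression_def X_def adjoint_entry[OF X[unfolded X_def]])
  then show ?thesis using cone_congruence[OF assms X] by simp
qed

lemma cone_carrier: "n \<ge> 1 \<Longrightarrow> V \<in> os_cone S n \<Longrightarrow> V \<in> carrier_mat n n"
  using cone_herm by (auto simp: herm_mats_def)

lemma star_zero: "os_star S 0 = 0"
  using star_add[of 0 0] by simp

lemma unit_diag_cone:
  assumes n: "n \<ge> 1" shows "unit_diag S n \<in> os_cone S n"
proof -
  have "0\<^sub>m n n \<in> herm_mats S n" using n cone_zero cone_herm by blast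
  then obtain r :: real where r: "r > 0" "scale_mat S (of_real r) (unit_diag S n) + 0\<^sub>m n n \<in> os_cone S n"
    using order_unit[OF n] by blast
  then have "scale_mat S (of_real (1/r)) (scale_mat S (of_real r) (unit_diag S n) + 0\<^sub>m n n) \<in> os_cone S n"
    using cone_scale[OF n, of _ "1/r"] by simp
  moreover have "scale_mat S (of_real (1/r)) (scale_mat S (of_real r) (unit_diag S n) + 0\<^sub>m n n) = unit_diag S n"
    using r by (intro eq_matI) (auto simp: scale_mat_def unit_diag_def simp flip: of_real_mult)
  ultimately show ?thesis by simp
qed

section \<open>Positive functionals are bounded by their value at the unit\<close>

text \<open>The matrix whose positivity says that \<open>v\<close> has order norm at most \<open>r\<close>.\<close>

definition ball_matrix :: "real \<Rightarrow> 'a \<Rightarrow> 'a mat" where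
  "ball_matrix r v = mat 2 2 (\<lambda>(i,j). if i = j then os_scale S (of_real r) (os_unit S)
                      else if i = 0 then v else os_star S v)"

definition positive_functional :: "('a \<Rightarrow> complex) \<Rightarrow> bool" where
  "positive_functional g \<longleftrightarrow> linear_functional S g \<and> (\<forall>v. mat 1 1 (\<lambda>_. v) \<in> os_cone S 1 \<longrightarrow> 0 \<le> g v)"

lemma positive_functional_unit: "positive_functional g \<Longrightarrow> 0 \<le> g (os_unit S)"
proof -
  have "unit_diag S 1 = mat 1 1 (\<lambda>_. os_unit S)" by (rule eq_matI) (auto simp: unit_diag_def)
  then show "positive_functional g \<Longrightarrow> 0 \<le> g (os_unit S)" using unit_diag_cone[of 1] by (simp add: positive_functional_def)
qed

text \<open>Compressing the matrix of the order norm by the vectors \<open>(1, s)\<close> with \<open>s\<close> a fourth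
  root of unity bounds the values at \<open>v + v\<^sup>*\<close> and \<open>\<i> (v - v\<^sup>*)\<close>, hence the real and
  imaginary parts of \<open>g v\<close>. The reality of these values also supplies that \<open>g\<close> respects the
  involution.\<close>

lemma positive_functional_bound:
  assumes g: "positive_functional g" and v: "ball_matrix r v \<in> os_cone S 2"
  shows "cmod (g v) \<le> 2 * r * Re (g (os_unit S))"
proof -
  have lin: "linear_functional S g" using g by (simp add: positive_functional_def)
  define e where "e = g (os_unit S)"
  have pos: "0 \<le> of_real (2 * r) * e + (s * g v + cnj s * g (os_star S v))" if s: "cmod s = 1" for s
  proof -
    define x where "x = (\<lambda>(p::nat) (i::nat). if p = 0 then 1 else s :: complex)"
    have ss: "cnj s * s = 1" using s complex_norm_square[of s] by (simp add: mult.commute)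
    have "compression S 2 1 x (ball_matrix r v) = mat 1 1 (\<lambda>_. compression S 2 1 x (ball_matrix r v) $$ (0,0))"
      by (rule eq_matI) (auto simp: compression_def)
    then have "0 \<le> g (compression S 2 1 x (ball_matrix r v) $$ (0,0))"
      using compression_cone[OF _ _ v, of 1 x] g by (simp add: positive_functional_def)
    also have "g (compression S 2 1 x (ball_matrix r v) $$ (0,0))
        = of_real (2 * r) * e + (s * g v + cnj s * g (os_star S v))"
      using ss by (simp add: compression_def ball_matrix_def x_def numeral_2_eq_2 linear_functionalD[OF lin] e_def algebra_simps)
    finally show ?thesis .
  qed
  let ?w = "g (os_star S v)"
  have e: "Im e = 0" using positive_functional_unit[OF g] by (simp add: e_def less_eq_complex_def)
  have "2 * r * Re e + (Re (g v) + Re ?w) \<ge> 0" "Im (g v) + Im ?w = 0"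
    using pos[of 1] e by (auto simp: less_eq_complex_def)
  moreover have "2 * r * Re e - (Re (g v) + Re ?w) \<ge> 0"
    using pos[of "-1"] e by (auto simp: less_eq_complex_def)
  moreover have "2 * r * Re e + (Im ?w - Im (g v)) \<ge> 0" "Re (g v) = Re ?w"
    using pos[of \<i>] e by (auto simp: less_eq_complex_def)
  moreover have "2 * r * Re e - (Im ?w - Im (g v)) \<ge> 0"
    using pos[of "-\<i>"] e by (auto simp: less_eq_complex_def)
  ultimately have "\<bar>Re (g v)\<bar> \<le> r * Re e" "\<bar>Im (g v)\<bar> \<le> r * Re e" by linarith+
  then show ?thesis using cmod_le[of "g v"] by (simp add: e_def)
qed

lemma ball_matrix_exists: "\<exists>r>0. ball_matrix r v \<in> os_cone S 2"
proof -
  define H where "H = mat 2 2 (\<lambda>(i,j). if i = j then 0 else if i = 0 then v else os_star S v)"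
  have "H \<in> herm_mats S 2"
    unfolding herm_mats_def
    by (auto simp: H_def star_mat_def star_zero star_star less_2_cases_iff intro!: eq_matI)
  then obtain r :: real where r: "r > 0" "scale_mat S (of_real r) (unit_diag S 2) + H \<in> os_cone S 2"
    using order_unit[of 2 H] by auto
  moreover have "scale_mat S (of_real r) (unit_diag S 2) + H = ball_matrix r v"
    by (rule eq_matI) (auto simp: H_def scale_mat_def unit_diag_def ball_matrix_def)
  ultimately show ?thesis by auto
qed

text \<open>The vector \<open>e\<^sub>i + s e\<^sub>j\<close>, written so that it is \<open>(1 + s) e\<^sub>i\<close> when \<open>i = j\<close>.\<close>

definition polar_vec :: "nat \<Rightarrow> nat \<Rightarrow> complex \<Rightarrow> nat \<Rightarrow> complex" where
  "polar_vec i j s l = of_bool (l = i) + s * of_bool (l = j)"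

text \<open>Polarization over the fourth roots of unity: the diagonal terms and the transposed
  entry cancel because these roots and their squares sum to zero.\<close>

lemma sesq_polar:
  assumes ij: "i < n" "j < n"
  shows "4 * P i j = (\<Sum>s\<in>{1,-1,\<i>,-\<i>}. cnj s * sesq n P (polar_vec i j s) (polar_vec i j s))"
proof -
  have single: "sesq n P (\<lambda>l. of_bool (l = a)) (\<lambda>l. of_bool (l = b)) = P a b" if "a < n" "b < n" for a b
  proof -
    have "sesq n P (\<lambda>l. of_bool (l = a)) (\<lambda>l. of_bool (l = b))
        = (\<Sum>p<n. if p = a then (\<Sum>q<n. if q = b then P p q else 0) else 0)"
      unfolding sesq_def by (intro sum.cong refl) auto
    then show ?thesis using that by simp
  qed
  have "sesq n P (polar_vec i j s) (polar_vec i j s) = P i i + s * P i j + cnj s * P j i + cnj s * s * P j j" for s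
    unfolding polar_vec_def sesq_add_left sesq_add_right sesq_scale_left sesq_scale_right
    using ij by (simp add: single algebra_simps)
  moreover have "\<i> \<noteq> -1" "\<i> \<noteq> 1" "-\<i> \<noteq> 1" "-\<i> \<noteq> -1" "\<i> \<noteq> - \<i>"
    "(1::complex) \<noteq> -1" "(1::complex) \<noteq> -\<i>" "(1::complex) \<noteq> \<i>" "-1 \<noteq> \<i>" by (auto simp: complex_eq_iff)
  ultimately show ?thesis by (simp add: algebra_simps)
qed

text \<open>Even if only the quadratic forms of a matrix of functionals are positive at positive
  elements of \<open>S\<close>, polarization controls its off-diagonal entries. The bound serves twice:
  it gives continuity for the order norm, and it shows that the matrix vanishes if all the
  quadratic forms vanish at the unit.\<close>

lemma matrix_of_functionals_bound:
  assumes f: "\<And>x. positive_functional (\<lambda>v. sesq n (\<lambda>i j. f i j v) x x)"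
    and ij: "i < n" "j < n" and v: "ball_matrix r v \<in> os_cone S 2"
  shows "cmod (f i j v) \<le> r / 2 * (\<Sum>s\<in>{1,-1,\<i>,-\<i>}.
           Re (sesq n (\<lambda>i j. f i j (os_unit S)) (polar_vec i j s) (polar_vec i j s)))"
proof -
  let ?g = "\<lambda>s v. sesq n (\<lambda>i j. f i j v) (polar_vec i j s) (polar_vec i j s)"
  have "4 * cmod (f i j v) = cmod (\<Sum>s\<in>{1,-1,\<i>,-\<i>}. cnj s * ?g s v)"
    unfolding sesq_polar[OF ij, of "\<lambda>i j. f i j v", symmetric] by (simp add: norm_mult)
  also have "\<dots> \<le> (\<Sum>s\<in>{1,-1,\<i>,-\<i>}. cmod (cnj s * ?g s v))" by (rule norm_sum)
  also have "\<dots> \<le> (\<Sum>s\<in>{1,-1,\<i>,-\<i>}. 2 * r * Re (?g s (os_unit S)))"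
  proof (rule sum_mono)
    fix s assume "s \<in> {1,-1,\<i>,-\<i>}"
    then have "cmod (cnj s * ?g s v) = cmod (?g s v)" by (auto simp: norm_mult)
    then show "cmod (cnj s * ?g s v) \<le> 2 * r * Re (?g s (os_unit S))"
      using positive_functional_bound[OF f v] by simp
  qed
  also have "\<dots> = 4 * (r / 2 * (\<Sum>s\<in>{1,-1,\<i>,-\<i>}. Re (?g s (os_unit S))))"
    unfolding sum_distrib_left by (intro sum.cong refl) simp
  finally show ?thesis by simp
qed

lemma linear_functional_sesq:
  assumes "\<And>i j. i < n \<Longrightarrow> j < n \<Longrightarrow> linear_functional S (f i j)"
  shows "linear_functional S (\<lambda>v. sesq n (\<lambda>i j. f i j v) x y)"
proof -
  have "sesq n (\<lambda>i j. f i j (u + v)) x y = sesq n (\<lambda>i j. f i j u) x y + sesq n (\<lambda>i j. f i j v) x y" for u v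
    unfolding sesq_def sum.distrib[symmetric]
    by (intro sum.cong refl) (simp add: linear_functionalD[OF assms] algebra_simps)
  moreover have "sesq n (\<lambda>i j. f i j (os_scale S c v)) x y = c * sesq n (\<lambda>i j. f i j v) x y" for c v
    unfolding sesq_def sum_distrib_left
    by (intro sum.cong refl) (simp add: linear_functionalD[OF assms] algebra_simps)
  ultimately show ?thesis by (simp add: linear_functional_def)
qed

lemma matrix_of_functionals_dual_space:
  assumes lin: "\<And>i j. i < n \<Longrightarrow> j < n \<Longrightarrow> linear_functional S (f i j)"
    and pos: "\<And>x v. mat 1 1 (\<lambda>_. v) \<in> os_cone S 1 \<Longrightarrow> 0 \<le> sesq n (\<lambda>i j. f i j v) x x"
    and ij: "i < n" "j < n"
  shows "f i j \<in> dual_space S"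
proof -
  have f: "positive_functional (\<lambda>v. sesq n (\<lambda>i j. f i j v) x x)" for x
    using lin pos by (simp add: positive_functional_def linear_functional_sesq)
  define K where "K = (\<Sum>s\<in>{1,-1,\<i>,-\<i>}.
      Re (sesq n (\<lambda>i j. f i j (os_unit S)) (polar_vec i j s) (polar_vec i j s)))"
  have K: "K \<ge> 0" unfolding K_def
    using positive_functional_unit[OF f] by (intro sum_nonneg) (auto simp: less_eq_complex_def)
  have "\<exists>\<delta>>0. \<forall>v. order_norm S (v - u) < \<delta> \<longrightarrow> cmod (f i j v - f i j u) < \<epsilon>" if e: "\<epsilon> > 0" for u \<epsilon>
  proof (intro exI conjI allI impI)
    define \<delta> where "\<delta> = \<epsilon> / (K / 2 + 1)"
    show d: "\<delta> > 0" using e K by (simp add: \<delta>_def)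
    fix v assume v: "order_norm S (v - u) < \<delta>"
    let ?R = "{r. 0 \<le> r \<and> ball_matrix r (v - u) \<in> os_cone S 2}"
    have "Inf ?R < \<delta>" using v unfolding order_norm_def ball_matrix_def .
    moreover have "?R \<noteq> {}" using ball_matrix_exists[of "v - u"] by (auto intro: less_imp_le)
    ultimately have "\<exists>r\<in>?R. r < \<delta>" by (intro cInf_lessD)
    then obtain r where r: "0 \<le> r" "ball_matrix r (v - u) \<in> os_cone S 2" "r < \<delta>" by blast
    have "f i j v - f i j u = f i j (v - u)" using linear_functionalD(5)[OF lin[OF ij]] by simp
    then have "cmod (f i j v - f i j u) \<le> r / 2 * K"
      using matrix_of_functionals_bound[of n f, OF f ij r(2)] by (simp add: K_def)
    also have "\<dots> \<le> r * (K / 2 + 1)" using r by (simp add: algebra_simps)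
    also have "\<dots> < \<delta> * (K / 2 + 1)" using r K by (intro mult_strict_right_mono) auto
    also have "\<dots> = \<epsilon>" using K by (simp add: \<delta>_def)
    finally show "cmod (f i j v - f i j u) < \<epsilon>" .
  qed
  then show ?thesis using lin[OF ij] by (simp add: dual_space_def linear_iff_linear_functional)
qed

section \<open>Complete positivity of \<open>k\<close>-positive maps into \<open>k \<times> k\<close> matrices\<close>

text \<open>Linearity moves the scalar coefficients of a quadratic form into the arguments of the
  functionals. This is how a statement about all vectors becomes one about compressions,
  which the cones absorb.\<close>

lemma linear_functional_compression:
  assumes f: "\<And>i j. i < n \<Longrightarrow> j < n \<Longrightarrow> linear_functional S (f i j)"
  shows "(\<Sum>i<n. \<Sum>j<n. f i j (compression S k n x V $$ (i,j)))
    = block_form n k (\<lambda>i j p q. f i j (V $$ (p,q))) (\<lambda>i p. x p i)"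
  unfolding block_form_def
  by (intro sum.cong refl) (simp add: compression_def linear_functional_sum[OF f] linear_functionalD[OF f] sum_distrib_left algebra_simps)

lemma positive_of_order_iff:
  "positive_of_order S n k \<phi> \<longleftrightarrow> (\<forall>V\<in>os_cone S n. \<forall>x. 0 \<le> block_form n k (\<lambda>i j p q. \<phi> (V $$ (i,j)) $$ (p,q)) x)"
  unfolding positive_of_order_def amplify_def psd_block_iff by simp

text \<open>As \<open>linear_functional_compression\<close>, with the two tensor factors interchanged: in an
  amplified map the blocks are indexed by the entries of \<open>V\<close> and not by those of the matrix
  of functionals.\<close>

lemma block_form_swap:
  assumes "\<And>p q. p < k \<Longrightarrow> q < k \<Longrightarrow> linear_functional S (f p q)"
  shows "block_form n k (\<lambda>i j p q. f p q (V $$ (i,j))) x = (\<Sum>p<k. \<Sum>q<k. f p q (compression S n k x V $$ (p,q)))"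
proof -
  have "(\<Sum>p<k. \<Sum>q<k. f p q (compression S n k x V $$ (p,q)))
      = block_form k n (\<lambda>p q i j. f p q (V $$ (i,j))) (\<lambda>p i. x i p)"
    using assms by (rule linear_functional_compression)
  then show ?thesis unfolding block_form_def by (subst sum_swap4) simp
qed

text \<open>The argument of Choi: the quadratic form of an amplification of \<open>\<phi>\<close>, of any size \<open>n\<close>,
  at any vector is the value of the fixed functional \<open>W \<mapsto> \<Sum>\<^sub>p\<^sub>q \<phi>(W\<^sub>p\<^sub>q)\<^sub>p\<^sub>q\<close> at a
  compression of a positive matrix to size \<open>k\<close>. This functional is itself a value of the
  quadratic form of the \<open>k\<close>-th amplification, at the vector \<open>\<Sum>\<^sub>p e\<^sub>p \<otimes> e\<^sub>p\<close>.\<close>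

lemma kpos_imp_CP:
  assumes k: "k \<ge> 1" and \<phi>: "matrix_map S k \<phi>" and pos: "positive_of_order S k k \<phi>"
  shows "\<phi> \<in> CP_maps S k"
proof -
  note lin = matrix_map_linear_functional[OF \<phi>]
  have base: "0 \<le> (\<Sum>p<k. \<Sum>q<k. \<phi> (W $$ (p,q)) $$ (p,q))" if W: "W \<in> os_cone S k" for W
  proof -
    have "0 \<le> block_form k k (\<lambda>i j p q. \<phi> (W $$ (i,j)) $$ (p,q)) (\<lambda>i p. of_bool (i = p))"
      using pos W by (simp add: positive_of_order_iff)
    also have "\<dots> = (\<Sum>i<k. \<Sum>j<k. \<Sum>p<k. if p = i then \<Sum>q<k. if q = j then \<phi> (W $$ (i,j)) $$ (p,q) else 0 else 0)"
      unfolding block_form_def by (intro sum.cong refl) auto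
    finally show ?thesis by simp
  qed
  have "positive_of_order S n k \<phi>" if n: "n \<ge> 1" for n
    unfolding positive_of_order_iff
  proof (intro ballI allI)
    fix V x assume "V \<in> os_cone S n"
    then show "0 \<le> block_form n k (\<lambda>i j p q. \<phi> (V $$ (i,j)) $$ (p,q)) x"
      using block_form_swap[of k "\<lambda>p q v. \<phi> v $$ (p,q)" n V x] lin base[OF compression_cone[OF n k]] by simp
  qed
  then show ?thesis using \<phi> by (simp add: CP_maps_def)
qed

section \<open>The predual of the minimal cone\<close>

lemma matrix_map_sum:
  assumes "matrix_map S k \<phi>" "matrix_map S k \<psi>"
  shows "matrix_map S k (\<lambda>v. \<phi> v + \<psi> v)"
proof -
  have carr: "\<phi> v \<in> carrier_mat k k" "\<psi> v \<in> carrier_mat k k" for v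
    using assms by (simp_all add: matrix_map_def)
  have dims: "dim_row (\<phi> v) = k" "dim_col (\<phi> v) = k" "dim_row (\<psi> v) = k" "dim_col (\<psi> v) = k" for v
    using carr[of v] by auto
  have "\<phi> (u + v) + \<psi> (u + v) = (\<phi> u + \<psi> u) + (\<phi> v + \<psi> v)" for u v
  proof -
    have "\<phi> (u + v) = \<phi> u + \<phi> v" "\<psi> (u + v) = \<psi> u + \<psi> v" using assms by (simp_all add: matrix_map_def)
    then show ?thesis by (intro eq_matI) (simp_all add: dims)
  qed
  moreover have "\<phi> (os_scale S c v) + \<psi> (os_scale S c v) = c \<cdot>\<^sub>m (\<phi> v + \<psi> v)" for c v
  proof -
    have "\<phi> (os_scale S c v) = c \<cdot>\<^sub>m \<phi> v" "\<psi> (os_scale S c v) = c \<cdot>\<^sub>m \<psi> v"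
      using assms by (simp_all add: matrix_map_def)
    then show ?thesis by (intro eq_matI) (simp_all add: dims distrib_left)
  qed
  ultimately show ?thesis using carr by (simp add: matrix_map_def)
qed

lemma matrix_map_congruence:
  fixes B :: "complex mat"
  assumes \<phi>: "matrix_map S k \<phi>" and B: "B \<in> carrier_mat k k"
  shows "matrix_map S k (\<lambda>v. mat_adjoint B * \<phi> v * B)"
proof -
  have carr: "\<phi> v \<in> carrier_mat k k" for v using \<phi> by (simp add: matrix_map_def)
  have B': "mat_adjoint B \<in> carrier_mat k k" using B by simp
  have "mat_adjoint B * (\<phi> u + \<phi> v) * B = mat_adjoint B * \<phi> u * B + mat_adjoint B * \<phi> v * B" for u v
    using mult_add_distrib_mat[OF B' carr carr, of u v]
      add_mult_distrib_mat[OF mult_carrier_mat[OF B' carr] mult_carrier_mat[OF B' carr] B, of u v] by simp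
  moreover have "mat_adjoint B * (c \<cdot>\<^sub>m \<phi> v) * B = c \<cdot>\<^sub>m (mat_adjoint B * \<phi> v * B)" for c v
    using mult_smult_distrib[OF B' carr, of c v]
      mult_smult_assoc_mat[OF mult_carrier_mat[OF B' carr] B, of c v] by simp
  moreover have "mat_adjoint B * \<phi> v * B \<in> carrier_mat k k" for v
    by (rule mult_carrier_mat[OF mult_carrier_mat[OF B' carr] B])
  ultimately show ?thesis using \<phi> by (simp add: matrix_map_def)
qed

lemma positive_of_order_congruence:
  assumes "matrix_map S k \<phi>" "B \<in> carrier_mat k k" "positive_of_order S n k \<phi>"
  shows "positive_of_order S n k (\<lambda>v. mat_adjoint B * \<phi> v * B)"
  using assms by (simp add: positive_of_order_iff block_form_congruence matrix_map_def)

definition scalar_map :: "nat \<Rightarrow> ('a \<Rightarrow> complex) \<Rightarrow> 'a \<Rightarrow> complex mat" where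
  "scalar_map k s v = mat k k (\<lambda>(p,q). if p = q then s v else 0)"

lemma scalar_map_matrix_map: "linear_functional S s \<Longrightarrow> matrix_map S k (scalar_map k s)"
  by (auto simp: matrix_map_def scalar_map_def linear_functionalD intro!: eq_matI)

text \<open>Positive functionals are completely positive: for a map into scalar multiples of the
  identity the quadratic form splits over the coordinates \<open>p\<close> into values of \<open>s\<close> at
  compressions of size one.\<close>

lemma scalar_map_positive:
  assumes s: "positive_functional s" and n: "n \<ge> 1" and V: "V \<in> os_cone S n"
  shows "0 \<le> block_form n k (\<lambda>i j p q. scalar_map k s (V $$ (i,j)) $$ (p,q)) x"
proof -
  have lin: "linear_functional S s" using s by (simp add: positive_functional_def)
  have diag: "0 \<le> (\<Sum>i<n. \<Sum>j<n. cnj (y i) * s (V $$ (i,j)) * y j)" for y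
  proof -
    let ?W = "compression S n 1 (\<lambda>i _. y i) V"
    have "?W = mat 1 1 (\<lambda>_. ?W $$ (0,0))" by (rule eq_matI) (auto simp: compression_def)
    then have "0 \<le> s (?W $$ (0,0))"
      using compression_cone[OF n _ V, of 1 "\<lambda>i _. y i"] s by (simp add: positive_functional_def)
    also have "s (?W $$ (0,0)) = (\<Sum>i<n. \<Sum>j<n. cnj (y i) * s (V $$ (i,j)) * y j)"
      by (simp add: compression_def linear_functional_sum[OF lin] linear_functionalD[OF lin] algebra_simps)
    finally show ?thesis .
  qed
  have "block_form n k (\<lambda>i j p q. scalar_map k s (V $$ (i,j)) $$ (p,q)) x
      = (\<Sum>i<n. \<Sum>j<n. \<Sum>p<k. \<Sum>q<k. if q = p then cnj (x i p) * s (V $$ (i,j)) * x j p else 0)"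
    unfolding block_form_def by (intro sum.cong refl) (simp add: scalar_map_def)
  also have "\<dots> = (\<Sum>i<n. \<Sum>j<n. \<Sum>p<k. cnj (x i p) * s (V $$ (i,j)) * x j p)" by simp
  also have "\<dots> = (\<Sum>i<n. \<Sum>p<k. \<Sum>j<n. cnj (x i p) * s (V $$ (i,j)) * x j p)"
    by (intro sum.cong refl sum.swap)
  also have "\<dots> = (\<Sum>p<k. \<Sum>i<n. \<Sum>j<n. cnj (x i p) * s (V $$ (i,j)) * x j p)"
    by (rule sum.swap)
  finally show ?thesis using diag[of "\<lambda>i. x i _"] by (simp add: sum_nonneg)
qed

lemma CP_positive_functional:
  assumes \<phi>: "\<phi> \<in> CP_maps S k"
  shows "positive_functional (\<lambda>v. sesq k (\<lambda>p q. \<phi> v $$ (p,q)) u u)"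
proof -
  have m: "matrix_map S k \<phi>" and p: "positive_of_order S 1 k \<phi>" using \<phi> by (auto simp: CP_maps_def)
  have "0 \<le> sesq k (\<lambda>p q. \<phi> v $$ (p,q)) u u" if v: "mat 1 1 (\<lambda>_. v) \<in> os_cone S 1" for v
  proof -
    have "0 \<le> block_form 1 k (\<lambda>i j p q. \<phi> (mat 1 1 (\<lambda>_. v) $$ (i,j)) $$ (p,q)) (\<lambda>_. u)"
      using p v by (simp add: positive_of_order_iff)
    then show ?thesis by (simp add: block_form_def sesq_def)
  qed
  then show ?thesis by (simp add: positive_functional_def linear_functional_sesq[OF matrix_map_linear_functional[OF m]])
qed

text \<open>A completely positive map becomes a congruence of a unital one after an arbitrarily
  small perturbation by a state times the identity matrix. The perturbation makes the value
  at the unit positive definite, so that \<open>congruent_to_one\<close> applies to it.\<close>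

lemma CP_perturbed_factorization:
  assumes \<phi>: "\<phi> \<in> CP_maps S k" and k: "k \<ge> 1" and s: "positive_functional s" "s (os_unit S) = 1" and r: "r > (0::real)"
  shows "\<exists>\<psi>\<in>unital_kpos_maps S k. \<exists>C\<in>carrier_mat k k.
    \<forall>v. \<phi> v + scalar_map k (\<lambda>w. of_real r * s w) v = mat_adjoint C * \<psi> v * C"
proof -
  define s' where "s' = (\<lambda>w. of_real r * s w)"
  have s': "positive_functional s'" using s r by (auto simp: s'_def positive_functional_def linear_functional_def less_eq_complex_def algebra_simps)
  define \<theta> where "\<theta> = (\<lambda>v. \<phi> v + scalar_map k s' v)"
  have \<phi>m: "matrix_map S k \<phi>" using \<phi> by (simp add: CP_maps_def)
  have sm: "matrix_map S k (scalar_map k s')" using s' by (simp add: positive_functional_def scalar_map_matrix_map)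
  have \<theta>m: "matrix_map S k \<theta>" unfolding \<theta>_def by (rule matrix_map_sum[OF \<phi>m sm])
  have carr: "\<theta> v \<in> carrier_mat k k" for v using \<theta>m by (simp add: matrix_map_def)
  have entry: "\<theta> v $$ (p,q) = \<phi> v $$ (p,q) + scalar_map k s' v $$ (p,q)" if "p < k" "q < k" for v p q
    using that sm by (simp add: \<theta>_def matrix_map_def scalar_map_def)
  have \<theta>pos: "positive_of_order S k k \<theta>"
    unfolding positive_of_order_iff
  proof (intro ballI allI)
    fix V x assume V: "V \<in> os_cone S k"
    have "block_form k k (\<lambda>i j p q. \<theta> (V $$ (i,j)) $$ (p,q)) x
      = block_form k k (\<lambda>i j p q. \<phi> (V $$ (i,j)) $$ (p,q) + 1 * scalar_map k s' (V $$ (i,j)) $$ (p,q)) x"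
      by (intro block_form_cong) (simp add: entry)
    also have "0 \<le> \<dots>"
      unfolding block_form_add_scaled
      using \<phi> V k scalar_map_positive[OF s' k V] by (simp add: CP_maps_def positive_of_order_iff)
    finally show "0 \<le> block_form k k (\<lambda>i j p q. \<theta> (V $$ (i,j)) $$ (p,q)) x" .
  qed
  have pd: "0 < sesq k (\<lambda>p q. \<theta> (os_unit S) $$ (p,q)) u u" if u: "\<exists>p<k. u p \<noteq> 0" for u
  proof -
    let ?N = "\<Sum>p<k. (cmod (u p))\<^sup>2"
    have N: "?N > 0"
    proof -
      obtain p where "p < k" "u p \<noteq> 0" using u by blast
      then show ?thesis by (intro sum_pos2[of _ p]) auto
    qed
    have "sesq k (\<lambda>p q. \<theta> (os_unit S) $$ (p,q)) u u
        = (\<Sum>p<k. \<Sum>q<k. cnj (u p) * \<phi> (os_unit S) $$ (p,q) * u q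
            + (if q = p then of_real (r * (cmod (u p))\<^sup>2) else 0))"
      unfolding sesq_def
      by (intro sum.cong refl)
        (use s in \<open>auto simp: entry scalar_map_def s'_def algebra_simps complex_norm_square simp del: of_real_power\<close>)
    also have "\<dots> = sesq k (\<lambda>p q. \<phi> (os_unit S) $$ (p,q)) u u + of_real (r * ?N)"
      by (simp add: sesq_def sum.distrib sum_distrib_left)
    also have "\<dots> > 0"
      using positive_functional_unit[OF CP_positive_functional[OF \<phi>, of u]] N r
      by (auto simp: less_complex_def less_eq_complex_def intro!: add_nonneg_pos mult_pos_pos)
    finally show ?thesis .
  qed
  obtain B C where B: "B \<in> carrier_mat k k" and C: "C \<in> carrier_mat k k"
    and one: "mat_adjoint B * \<theta> (os_unit S) * B = 1\<^sub>m k" and BC: "B * C = 1\<^sub>m k"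
    using congruent_to_one[OF carr pd] by blast
  define \<psi> where "\<psi> = (\<lambda>v. mat_adjoint B * \<theta> v * B)"
  have "\<psi> \<in> unital_kpos_maps S k"
    using one matrix_map_congruence[OF \<theta>m B] positive_of_order_congruence[OF \<theta>m B \<theta>pos]
    by (simp add: unital_kpos_maps_def \<psi>_def)
  moreover have "\<theta> v = mat_adjoint C * \<psi> v * C" for v
  proof -
    have CB: "mat_adjoint C * mat_adjoint B = 1\<^sub>m k"
    proof (rule eq_matI)
      fix i j assume "i < dim_row (1\<^sub>m k)" "j < dim_col (1\<^sub>m k)"
      then have ij: "i < k" "j < k" by auto
      have "(mat_adjoint C * mat_adjoint B) $$ (i,j) = cnj ((B * C) $$ (j,i))"
        using ij B C by (simp add: scalar_prod_def adjoint_entry[OF B] adjoint_entry[OF C] mult.commute)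
      then show "(mat_adjoint C * mat_adjoint B) $$ (i,j) = 1\<^sub>m k $$ (i,j)"
        using ij by (simp add: BC)
    qed (use B C in auto)
    have B': "mat_adjoint B \<in> carrier_mat k k" and C': "mat_adjoint C \<in> carrier_mat k k" using B C by auto
    have "mat_adjoint C * \<psi> v * C = mat_adjoint C * (mat_adjoint B * (\<theta> v * (B * C)))"
    proof -
      have TB: "\<theta> v * B \<in> carrier_mat k k" by (rule mult_carrier_mat[OF carr B])
      have "\<psi> v * C = mat_adjoint B * (\<theta> v * B * C)"
        unfolding \<psi>_def assoc_mult_mat[OF B' carr B] by (rule assoc_mult_mat[OF B' TB C])
      also have "\<theta> v * B * C = \<theta> v * (B * C)" by (rule assoc_mult_mat[OF carr B C])
      finally have "\<psi> v * C = mat_adjoint B * (\<theta> v * (B * C))" .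
      moreover have "\<psi> v \<in> carrier_mat k k"
        unfolding \<psi>_def by (intro mult_carrier_mat[OF mult_carrier_mat[OF B' carr] B])
      ultimately show ?thesis using assoc_mult_mat[OF C' _ C] by simp
    qed
    also have "\<dots> = mat_adjoint C * mat_adjoint B * \<theta> v"
      using B' C' carr[of v] by (simp add: BC assoc_mult_mat[of _ k k _ k _ k])
    also have "\<dots> = \<theta> v" using carr[of v] by (simp add: CB)
    finally show ?thesis by simp
  qed
  ultimately show ?thesis using C by (auto simp: \<theta>_def s'_def)
qed

text \<open>If a state exists, factor the perturbed map through a unital one and let the
  perturbation shrink. If there is none, as for the zero space, every positive functional
  vanishes at the unit, since it could be normalised otherwise; then every completely
  positive map is zero by polarization.\<close>

lemma C_kmin_CP_nonneg:
  assumes A: "A \<in> C_kmin S k n" and \<phi>: "\<phi> \<in> CP_maps S k" and k: "k \<ge> 1"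
  shows "0 \<le> block_form n k (\<lambda>i j p q. \<phi> (A $$ (i,j)) $$ (p,q)) x"
proof (cases "\<exists>s. positive_functional s \<and> s (os_unit S) = 1")
  case True
  then obtain s where s: "positive_functional s" "s (os_unit S) = 1" by blast
  have m: "matrix_map S k \<phi>" using \<phi> by (simp add: CP_maps_def)
  show ?thesis
  proof (rule nonneg_if_perturbed_nonneg)
    fix r :: real assume r: "r > 0"
    obtain \<psi> C where \<psi>: "\<psi> \<in> unital_kpos_maps S k" and C: "C \<in> carrier_mat k k"
      and eq: "\<And>v. \<phi> v + scalar_map k (\<lambda>w. of_real r * s w) v = mat_adjoint C * \<psi> v * C"
      using CP_perturbed_factorization[OF \<phi> k s r] by blast
    have \<psi>c: "\<psi> v \<in> carrier_mat k k" for v using \<psi> by (simp add: unital_kpos_maps_def matrix_map_def)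
    have "block_form n k (\<lambda>i j p q. \<phi> (A $$ (i,j)) $$ (p,q)) x
        + of_real r * block_form n k (\<lambda>i j p q. scalar_map k s (A $$ (i,j)) $$ (p,q)) x
      = block_form n k (\<lambda>i j p q. (\<phi> (A $$ (i,j)) + scalar_map k (\<lambda>w. of_real r * s w) (A $$ (i,j))) $$ (p,q)) x"
      unfolding block_form_add_scaled[symmetric]
      using m by (intro block_form_cong) (auto simp: scalar_map_def matrix_map_def)
    also have "\<dots> = block_form n k (\<lambda>i j p q. \<psi> (A $$ (i,j)) $$ (p,q)) (\<lambda>i s. \<Sum>p<k. C $$ (s,p) * x i p)"
      unfolding eq by (rule block_form_congruence[OF C \<psi>c])
    also have "\<dots> \<ge> 0"
      using A \<psi> by (simp add: C_kmin_def amplify_def psd_block_iff)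
    finally show "0 \<le> block_form n k (\<lambda>i j p q. \<phi> (A $$ (i,j)) $$ (p,q)) x
        + of_real r * block_form n k (\<lambda>i j p q. scalar_map k s (A $$ (i,j)) $$ (p,q)) x" .
  qed
next
  case False
  have zero: "g (os_unit S) = 0" if g: "positive_functional g" for g
  proof (rule ccontr)
    assume nz: "g (os_unit S) \<noteq> 0"
    define t where "t = Re (g (os_unit S))"
    have t: "t > 0" "g (os_unit S) = of_real t"
      using positive_functional_unit[OF g] nz by (auto simp: t_def less_eq_complex_def complex_eq_iff)
    have "positive_functional (\<lambda>v. of_real (1/t) * g v)"
      using g t by (auto simp: positive_functional_def linear_functional_def less_eq_complex_def algebra_simps add_divide_distrib)
    moreover have "of_real (1/t) * g (os_unit S) = 1" using t by (simp flip: of_real_mult)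
    ultimately show False using False by blast
  qed
  have "\<phi> v $$ (p,q) = 0" if pq: "p < k" "q < k" for v p q
  proof -
    obtain r where "ball_matrix r v \<in> os_cone S 2" using ball_matrix_exists by blast
    from matrix_of_functionals_bound[of k "\<lambda>p q v. \<phi> v $$ (p,q)", OF CP_positive_functional[OF \<phi>] pq this]
    show ?thesis by (simp add: zero[OF CP_positive_functional[OF \<phi>]])
  qed
  then show ?thesis by (simp add: block_form_def)
qed

text \<open>The diagonal blocks contribute separately: the \<open>l\<close>-th block of rows of \<open>X\<close>, read as
  one vector, is where the quadratic form of the amplification of \<open>\<phi>\<^sub>l\<close> is evaluated.\<close>

lemma pairing_Q_kmin:
  assumes X: "X \<in> carrier_mat (m * k) n" and \<phi>s: "length \<phi>s = m" 
  shows "pairing n (bimod_prod dual_scale (mat_adjoint X) (diag_block_mat (map (mat_of_map k) \<phi>s)) X) V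
    = (\<Sum>l<m. block_form n k (\<lambda>i j p q. (\<phi>s ! l) (V $$ (i,j)) $$ (p,q)) (\<lambda>i p. X $$ (l * k + p, i)))"
proof -
  have X': "mat_adjoint X \<in> carrier_mat n (m * k)" using X by simp
  have "(bimod_prod dual_scale (mat_adjoint X) (diag_block_mat (map (mat_of_map k) \<phi>s)) X $$ (i,j)) w
      = (\<Sum>l<m. \<Sum>p<k. \<Sum>q<k. cnj (X $$ (l * k + p, i)) * (\<phi>s ! l) w $$ (p,q) * X $$ (l * k + q, j))"
    if ij: "i < n" "j < n" for i j w
  proof -
    have "bimod_prod dual_scale (mat_adjoint X) (diag_block_mat (map (mat_of_map k) \<phi>s)) X $$ (i,j)
      = (\<Sum>l<m. \<Sum>p<k. \<Sum>q<k. dual_scale (mat_adjoint X $$ (i, l * k + p) * X $$ (l * k + q, j))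
          (map (mat_of_map k) \<phi>s ! l $$ (p,q)))"
      using \<phi>s by (intro bimod_diag_entry[OF X' X _ _ _ ij])
        (auto simp: mat_of_map_def dual_scale_def zero_fun_def)
    then show ?thesis
      using \<phi>s ij by (auto simp: fun_sum_apply dual_scale_def mat_of_map_def adjoint_entry[OF X] mult_index_less
          intro!: sum.cong)
  qed
  then have "pairing n (bimod_prod dual_scale (mat_adjoint X) (diag_block_mat (map (mat_of_map k) \<phi>s)) X) V
    = (\<Sum>i<n. \<Sum>j<n. \<Sum>l<m. \<Sum>p<k. \<Sum>q<k.
        cnj (X $$ (l * k + p, i)) * (\<phi>s ! l) (V $$ (i,j)) $$ (p,q) * X $$ (l * k + q, j))"
    by (simp add: pairing_def)
  also have "\<dots> = (\<Sum>i<n. \<Sum>l<m. \<Sum>j<n. \<Sum>p<k. \<Sum>q<k.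
        cnj (X $$ (l * k + p, i)) * (\<phi>s ! l) (V $$ (i,j)) $$ (p,q) * X $$ (l * k + q, j))"
    by (intro sum.cong refl sum.swap)
  also have "\<dots> = (\<Sum>l<m. \<Sum>i<n. \<Sum>j<n. \<Sum>p<k. \<Sum>q<k.
        cnj (X $$ (l * k + p, i)) * (\<phi>s ! l) (V $$ (i,j)) $$ (p,q) * X $$ (l * k + q, j))"
    by (rule sum.swap)
  finally show ?thesis by (simp add: block_form_def)
qed

text \<open>Membership in the minimal cone tests unital \<open>k\<close>-positive maps, membership in the
  predual tests completely positive ones. The former are among the latter by \<open>kpos_imp_CP\<close>,
  and a single such map with one block of rows already realises every quadratic form; the
  converse is \<open>C_kmin_CP_nonneg\<close>.\<close>

theorem predual_Q_kmin:
  assumes k: "k \<ge> 1"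
  shows "predual_cone n (Q_kmin S k n) = C_kmin S k n"
proof (intro equalityI subsetI)
  fix A assume A: "A \<in> predual_cone n (Q_kmin S k n)"
  have "0 \<le> block_form n k (\<lambda>i j p q. \<phi> (A $$ (i,j)) $$ (p,q)) x"
    if \<phi>: "\<phi> \<in> unital_kpos_maps S k" for \<phi> x
  proof -
    have CP: "\<phi> \<in> CP_maps S k" using \<phi> kpos_imp_CP[OF k] by (simp add: unital_kpos_maps_def)
    define X where "X = mat (1 * k) n (\<lambda>(p,i). x i p)"
    have X: "X \<in> carrier_mat (1 * k) n" by (simp add: X_def)
    have "bimod_prod dual_scale (mat_adjoint X) (diag_block_mat (map (mat_of_map k) [\<phi>])) X \<in> Q_kmin S k n"
      unfolding Q_kmin_def mem_Collect_eq
      by (intro exI[of _ X] exI[of _ "[\<phi>]"] exI[of _ "1::nat"] conjI refl) (use X CP in auto)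
    then have "0 \<le> pairing n (bimod_prod dual_scale (mat_adjoint X) (diag_block_mat (map (mat_of_map k) [\<phi>])) X) A"
      using A unfolding predual_cone_def by blast
    also have "\<dots> = block_form n k (\<lambda>i j p q. \<phi> (A $$ (i,j)) $$ (p,q)) (\<lambda>i p. X $$ (p, i))"
      by (subst pairing_Q_kmin[OF X]) simp_all
    also have "\<dots> = block_form n k (\<lambda>i j p q. \<phi> (A $$ (i,j)) $$ (p,q)) x"
      unfolding block_form_def by (intro sum.cong refl) (simp add: X_def)
    finally show ?thesis .
  qed
  then show "A \<in> C_kmin S k n"
    using A by (simp add: C_kmin_def predual_cone_def amplify_def psd_block_iff)
next
  fix A assume A: "A \<in> C_kmin S k n"
  have "0 \<le> pairing n F A" if F_in: "F \<in> Q_kmin S k n" for F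
  proof -
    obtain X \<phi>s m where F: "F = bimod_prod dual_scale (mat_adjoint X) (diag_block_mat (map (mat_of_map k) \<phi>s)) X"
      and X: "X \<in> carrier_mat (m * k) n" and \<phi>s: "length \<phi>s = m" "set \<phi>s \<subseteq> CP_maps S k"
      using F_in unfolding Q_kmin_def by blast
    have "\<phi>s ! l \<in> CP_maps S k" if "l < m" for l using \<phi>s that by auto
    then show ?thesis unfolding F pairing_Q_kmin[OF X \<phi>s(1)]
      by (intro sum_nonneg C_kmin_CP_nonneg[OF A _ k]) auto
  qed
  then show "A \<in> predual_cone n (Q_kmin S k n)" using A by (simp add: predual_cone_def C_kmin_def)
qed

section \<open>The dual of the maximal cone\<close>

lemma pairing_linear_on_mats:
  assumes F: "\<And>i j. i < n \<Longrightarrow> j < n \<Longrightarrow> linear_functional S (F $$ (i,j))"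
  shows "linear_on_mats S n (pairing n F)"
proof -
  have "pairing n F (A + B) = pairing n F A + pairing n F B"
    if "A \<in> carrier_mat n n" "B \<in> carrier_mat n n" for A B
    unfolding pairing_def sum.distrib[symmetric]
    using that by (intro sum.cong refl) (simp add: linear_functionalD[OF F])
  moreover have "pairing n F (scale_mat S c A) = c * pairing n F A" if "A \<in> carrier_mat n n" for c A
    unfolding pairing_def sum_distrib_left
    using that by (intro sum.cong refl) (simp add: scale_mat_def linear_functionalD[OF F])
  ultimately show ?thesis by (simp add: linear_on_mats_def)
qed

text \<open>Additivity over the finitely many entries of \<open>A\<close>, by induction on the set of positions
  that have been filled in.\<close>

lemma linear_on_mats_eq_pairing:
  assumes f: "linear_on_mats S n f" and A: "A \<in> carrier_mat n n"
  shows "f A = pairing n (mat n n (\<lambda>(i,j). \<lambda>v. f (elem_tensor n i j v))) A"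
proof -
  have add: "f (A + B) = f A + f B" if "A \<in> carrier_mat n n" "B \<in> carrier_mat n n" for A B
    using f that by (simp add: linear_on_mats_def)
  have "f (0\<^sub>m n n) = 0" using add[of "0\<^sub>m n n" "0\<^sub>m n n"] by simp
  then have zero: "f (mat n n (\<lambda>z. 0)) = 0" by (simp add: zero_mat_def)
  define part where "part T = mat n n (\<lambda>z. if z \<in> T then A $$ z else 0)" for T
  have part_sum: "f (part T) = (\<Sum>z\<in>T. f (elem_tensor n (fst z) (snd z) (A $$ z)))"
    if "finite T" for T
    using that
  proof (induction T rule: finite_induct)
    case empty then show ?case using zero by (simp add: part_def)
  next
    case (insert z T)
    have "part (insert z T) = elem_tensor n (fst z) (snd z) (A $$ z) + part T"
      using insert.hyps by (intro eq_matI) (auto simp: part_def elem_tensor_def)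
    then show ?case using insert by (simp add: add part_def elem_tensor_def)
  qed
  have "A = part ({..<n} \<times> {..<n})" using A by (intro eq_matI) (auto simp: part_def)
  then have "f A = (\<Sum>z\<in>{..<n} \<times> {..<n}. f (elem_tensor n (fst z) (snd z) (A $$ z)))"
    using part_sum[of "{..<n} \<times> {..<n}"] by simp
  then show ?thesis by (simp add: pairing_def sum.cartesian_product' split_def)
qed

text \<open>A functional on matrices and its matrix of functionals determine each other through
  the pairing, which removes the existential quantifier from the dual cone.\<close>

lemma dual_cone_iff:
  assumes P: "P \<subseteq> carrier_mat n n"
  shows "F \<in> dual_cone S n P \<longleftrightarrow>
    F \<in> carrier_mat n n \<and> (\<forall>i<n. \<forall>j<n. linear_functional S (F $$ (i,j))) \<and> (\<forall>A\<in>P. 0 \<le> pairing n F A)"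
proof (intro iffI conjI allI ballI impI)
  assume "F \<in> dual_cone S n P"
  then obtain f where F: "F = mat n n (\<lambda>(i,j). \<lambda>v. f (elem_tensor n i j v))"
    and f: "linear_on_mats S n f" and pos: "\<forall>A\<in>P. 0 \<le> f A"
    unfolding dual_cone_def by blast
  show "F \<in> carrier_mat n n" by (simp add: F)
  show "0 \<le> pairing n F A" if A: "A \<in> P" for A
  proof -
    have "A \<in> carrier_mat n n" using A P by blast
    then show ?thesis using A pos by (simp add: F flip: linear_on_mats_eq_pairing[OF f])
  qed
  fix i j assume ij: "i < n" "j < n"
  have "elem_tensor n i j (u + v) = elem_tensor n i j u + elem_tensor n i j v"
    "elem_tensor n i j (os_scale S c v) = scale_mat S c (elem_tensor n i j v)"
    "elem_tensor n i j v \<in> carrier_mat n n" for u v c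
    by (auto simp: elem_tensor_def scale_mat_def)
  then show "linear_functional S (F $$ (i,j))" using f ij by (simp add: F linear_functional_def linear_on_mats_def)
next
  assume F: "F \<in> carrier_mat n n \<and> (\<forall>i<n. \<forall>j<n. linear_functional S (F $$ (i,j))) \<and> (\<forall>A\<in>P. 0 \<le> pairing n F A)"
  have "F = mat n n (\<lambda>(i,j). \<lambda>v. pairing n F (elem_tensor n i j v))"
  proof (rule eq_matI)
    fix i j assume "i < dim_row (mat n n (\<lambda>(i,j). \<lambda>v. pairing n F (elem_tensor n i j v)))"
      "j < dim_col (mat n n (\<lambda>(i,j). \<lambda>v. pairing n F (elem_tensor n i j v)))"
    then have ij: "i < n" "j < n" by auto
    have "pairing n F (elem_tensor n i j v) = (F $$ (i,j)) v" for v
    proof -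
      have "pairing n F (elem_tensor n i j v)
          = (\<Sum>p<n. \<Sum>q<n. if p = i then if q = j then (F $$ (p,q)) v else 0 else 0)"
        unfolding pairing_def
      proof (intro sum.cong refl)
        fix p q assume pq: "p \<in> {..<n}" "q \<in> {..<n}"
        then have "(F $$ (p,q)) 0 = 0" using F by (intro linear_functionalD(3)) auto
        then show "(F $$ (p,q)) (elem_tensor n i j v $$ (p,q))
            = (if p = i then if q = j then (F $$ (p,q)) v else 0 else 0)"
          using pq by (auto simp: elem_tensor_def)
      qed
      then show ?thesis using ij by (simp add: sum_if_const)
    qed
    then show "F $$ (i,j) = mat n n (\<lambda>(i,j). \<lambda>v. pairing n F (elem_tensor n i j v)) $$ (i,j)"
      using ij by auto
  qed (use F in auto)
  moreover have "linear_on_mats S n (pairing n F)" using F by (intro pairing_linear_on_mats) auto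
  ultimately show "F \<in> dual_cone S n P" unfolding dual_cone_def using F by blast
qed

lemma pairing_D_kmax:
  assumes F: "\<And>i j. i < n \<Longrightarrow> j < n \<Longrightarrow> linear_functional S (F $$ (i,j))"
    and A: "A \<in> carrier_mat n (m * k)"
    and Ds: "length Ds = m" "\<And>D. D \<in> set Ds \<Longrightarrow> D \<in> carrier_mat k k"
  shows "pairing n F (bimod_prod (os_scale S) A (diag_block_mat Ds) (mat_adjoint A))
    = (\<Sum>l<m. block_form n k (\<lambda>i j p q. (F $$ (i,j)) (Ds ! l $$ (p,q))) (\<lambda>i p. cnj (A $$ (i, l * k + p))))"
proof -
  have A': "mat_adjoint A \<in> carrier_mat (m * k) n" using A by simp
  have "(F $$ (i,j)) (bimod_prod (os_scale S) A (diag_block_mat Ds) (mat_adjoint A) $$ (i,j))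
      = (\<Sum>l<m. \<Sum>p<k. \<Sum>q<k. A $$ (i, l * k + p) * (F $$ (i,j)) (Ds ! l $$ (p,q)) * cnj (A $$ (j, l * k + q)))"
    if ij: "i < n" "j < n" for i j
  proof -
    have "bimod_prod (os_scale S) A (diag_block_mat Ds) (mat_adjoint A) $$ (i,j)
      = (\<Sum>l<m. \<Sum>p<k. \<Sum>q<k. os_scale S (A $$ (i, l * k + p) * mat_adjoint A $$ (l * k + q, j)) (Ds ! l $$ (p,q)))"
      by (intro bimod_diag_entry[OF A A' Ds _ ij]) auto
    then show ?thesis
      using ij by (auto simp: linear_functional_sum[OF F] linear_functionalD[OF F] adjoint_entry[OF A] mult_index_less intro!: sum.cong)
  qed
  then have "pairing n F (bimod_prod (os_scale S) A (diag_block_mat Ds) (mat_adjoint A))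
    = (\<Sum>i<n. \<Sum>j<n. \<Sum>l<m. \<Sum>p<k. \<Sum>q<k.
        A $$ (i, l * k + p) * (F $$ (i,j)) (Ds ! l $$ (p,q)) * cnj (A $$ (j, l * k + q)))"
    by (simp add: pairing_def)
  also have "\<dots> = (\<Sum>i<n. \<Sum>l<m. \<Sum>j<n. \<Sum>p<k. \<Sum>q<k.
        A $$ (i, l * k + p) * (F $$ (i,j)) (Ds ! l $$ (p,q)) * cnj (A $$ (j, l * k + q)))"
    by (intro sum.cong refl sum.swap)
  also have "\<dots> = (\<Sum>l<m. \<Sum>i<n. \<Sum>j<n. \<Sum>p<k. \<Sum>q<k.
        A $$ (i, l * k + p) * (F $$ (i,j)) (Ds ! l $$ (p,q)) * cnj (A $$ (j, l * k + q)))"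
    by (rule sum.swap)
  finally show ?thesis by (simp add: block_form_def)
qed

text \<open>A compression of \<open>V\<close> is a product \<open>A V A\<^sup>*\<close> with one diagonal block. Membership in the
  closed cone requires adding \<open>r e \<otimes> I\<^sub>n\<close>, which is done inside the same product by \<open>n\<close>
  further blocks \<open>e \<otimes> I\<^sub>k\<close>, each contributing one diagonal position.\<close>

lemma compression_C_kmax:
  assumes k: "k \<ge> 1" and V: "V \<in> os_cone S k"
  shows "compression S k n x V \<in> C_kmax S k n"
proof -
  have "scale_mat S (of_real r) (unit_diag S n) + compression S k n x V \<in> D_kmax S k n"
    if r: "r > 0" for r :: real
  proof -
    \<comment> \<open>\<open>a l i p\<close> is the entry of \<open>A\<close> in row \<open>i\<close> and in column \<open>p\<close> of its \<open>l\<close>-th block of columns; block \<open>i + 1\<close>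
      has \<open>sqrt r\<close> in position \<open>(i, 0)\<close> and produces the diagonal entry \<open>r e\<close> in row \<open>i\<close>.\<close>
    define Ds where "Ds = V # replicate n (unit_diag S k)"
    define a where "a = (\<lambda>l i p. if l = 0 then cnj (x p i)
      else if i + 1 = l \<and> p = 0 then of_real (sqrt r) else 0 :: complex)"
    define A where "A = mat n (Suc n * k) (\<lambda>(i,c). a (c div k) i (c mod k))"
    have A: "A \<in> carrier_mat n (Suc n * k)" by (simp add: A_def)
    have Ae: "A $$ (i, l * k + p) = a l i p" if "i < n" "l < Suc n" "p < k" for i l p
      using that mult_index_less[of l "Suc n" p k] by (simp add: A_def)
    have A': "mat_adjoint A \<in> carrier_mat (Suc n * k) n" using A by simp
    have Ds: "length Ds = Suc n" "set Ds \<subseteq> os_cone S k"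
      using V unit_diag_cone[OF k] by (auto simp: Ds_def)
    have Dc: "D \<in> carrier_mat k k" if "D \<in> set Ds" for D using that Ds cone_carrier[OF k] by blast
    have "bimod_prod (os_scale S) A (diag_block_mat Ds) (mat_adjoint A) \<in> D_kmax S k n"
      unfolding D_kmax_def mem_Collect_eq
      by (intro exI[of _ A] exI[of _ Ds] exI[of _ "Suc n"] conjI refl) (use A Ds in auto)
    moreover have "bimod_prod (os_scale S) A (diag_block_mat Ds) (mat_adjoint A)
        = scale_mat S (of_real r) (unit_diag S n) + compression S k n x V"
    proof (rule eq_matI)
      fix i j assume "i < dim_row (scale_mat S (of_real r) (unit_diag S n) + compression S k n x V)"
        "j < dim_col (scale_mat S (of_real r) (unit_diag S n) + compression S k n x V)"
      then have ij: "i < n" "j < n" by (auto simp: compression_def)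
      have "bimod_prod (os_scale S) A (diag_block_mat Ds) (mat_adjoint A) $$ (i,j)
        = (\<Sum>l<Suc n. \<Sum>p<k. \<Sum>q<k. os_scale S (A $$ (i, l * k + p) * mat_adjoint A $$ (l * k + q, j)) (Ds ! l $$ (p,q)))"
        by (intro bimod_diag_entry[OF A A' Ds(1) Dc _ ij]) auto
      also have "\<dots> = (\<Sum>l<Suc n. \<Sum>p<k. \<Sum>q<k. os_scale S (a l i p * cnj (a l j q)) (Ds ! l $$ (p,q)))"
        using ij by (intro sum.cong refl) (simp add: Ae adjoint_entry[OF A] mult_index_less del: mult_Suc)
      also have "\<dots> = (\<Sum>p<k. \<Sum>q<k. os_scale S (cnj (x p i) * x q j) (V $$ (p,q)))
          + (\<Sum>l<n. \<Sum>p<k. \<Sum>q<k. os_scale S (a (Suc l) i p * cnj (a (Suc l) j q)) (Ds ! Suc l $$ (p,q)))"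
        unfolding sum.lessThan_Suc_shift by (simp add: a_def Ds_def)
      also have "(\<Sum>l<n. \<Sum>p<k. \<Sum>q<k. os_scale S (a (Suc l) i p * cnj (a (Suc l) j q)) (Ds ! Suc l $$ (p,q)))
          = (\<Sum>l<n. \<Sum>p<k. \<Sum>q<k. if l = i then if p = 0 then if q = 0 then
              (if i = j then os_scale S (of_real r) (os_unit S) else 0) else 0 else 0 else 0)"
      proof (intro sum.cong refl)
        fix l p q assume "l \<in> {..<n}" "p \<in> {..<k}" "q \<in> {..<k}"
        then show "os_scale S (a (Suc l) i p * cnj (a (Suc l) j q)) (Ds ! Suc l $$ (p,q))
            = (if l = i then if p = 0 then if q = 0 then
              (if i = j then os_scale S (of_real r) (os_unit S) else 0) else 0 else 0 else 0)"
          using k r by (auto simp: a_def Ds_def unit_diag_def simp flip: of_real_mult)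
      qed
      also have "\<dots> = (if i = j then os_scale S (of_real r) (os_unit S) else 0)"
        using ij k by (simp add: sum_if_const)
      finally show "bimod_prod (os_scale S) A (diag_block_mat Ds) (mat_adjoint A) $$ (i,j)
          = (scale_mat S (of_real r) (unit_diag S n) + compression S k n x V) $$ (i,j)"
        using ij by (simp add: compression_def scale_mat_def unit_diag_def add.commute)
    qed (use A in \<open>auto simp: bimod_prod_def compression_def\<close>)
    ultimately show ?thesis by simp
  qed
  then show ?thesis by (simp add: C_kmax_def compression_def)
qed

lemma pairing_compression:
  assumes F: "\<And>i j. i < n \<Longrightarrow> j < n \<Longrightarrow> linear_functional S (F $$ (i,j))"
  shows "pairing n F (compression S k n x V) = block_form n k (\<lambda>i j p q. (F $$ (i,j)) (V $$ (p,q))) (\<lambda>i p. x p i)"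
  unfolding pairing_def by (rule linear_functional_compression[OF F])

text \<open>The continuity required of the entries is automatic from positivity. Placing a
  positive element \<open>v\<close> in the corner of a \<open>k \<times> k\<close> matrix shows that the matrix of values at
  \<open>v\<close> is positive, and \<open>matrix_of_functionals_dual_space\<close> then applies.\<close>

lemma Q_kmax_iff:
  assumes k: "k \<ge> 1"
  shows "F \<in> Q_kmax S k n \<longleftrightarrow> F \<in> carrier_mat n n \<and> (\<forall>i<n. \<forall>j<n. linear_functional S (F $$ (i,j))) \<and>
    (\<forall>V\<in>os_cone S k. \<forall>x. 0 \<le> block_form n k (\<lambda>i j p q. (F $$ (i,j)) (V $$ (p,q))) x)"
proof -
  have form: "psd_mat (n * k) (block_matrix n k (\<lambda>i j. map_mat (F $$ (i,j)) V)) \<longleftrightarrow>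
      (\<forall>x. 0 \<le> block_form n k (\<lambda>i j p q. (F $$ (i,j)) (V $$ (p,q))) x)" if "V \<in> os_cone S k" for V
  proof -
    have "block_form n k (\<lambda>i j p q. map_mat (F $$ (i,j)) V $$ (p,q)) x
        = block_form n k (\<lambda>i j p q. (F $$ (i,j)) (V $$ (p,q))) x" for x
      using cone_carrier[OF k that] by (intro block_form_cong) auto
    then show ?thesis unfolding psd_block_iff by simp
  qed
  have cont: "F $$ (i,j) \<in> dual_space S"
    if lin: "\<forall>i<n. \<forall>j<n. linear_functional S (F $$ (i,j))" and ij: "i < n" "j < n"
    and pos: "\<forall>V\<in>os_cone S k. \<forall>x. 0 \<le> block_form n k (\<lambda>i j p q. (F $$ (i,j)) (V $$ (p,q))) x" for i j
  proof (rule matrix_of_functionals_dual_space[where f = "\<lambda>i j. F $$ (i,j)", OF _ _ ij])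
    fix x v assume v: "mat 1 1 (\<lambda>_. v) \<in> os_cone S 1"
    let ?V = "compression S 1 k (\<lambda>_ p. of_bool (p = 0)) (mat 1 1 (\<lambda>_. v))"
    have "0 \<le> block_form n k (\<lambda>i j p q. (F $$ (i,j)) (?V $$ (p,q))) (\<lambda>i _. x i)"
      using pos compression_cone[OF _ k v, of "\<lambda>_ p. of_bool (p = 0)"] by simp
    also have "\<dots> = (\<Sum>i<n. \<Sum>j<n. \<Sum>p<k. \<Sum>q<k. if p = 0 then if q = 0 then cnj (x i) * (F $$ (i,j)) v * x j else 0 else 0)"
      unfolding block_form_def
    proof (intro sum.cong refl)
      fix i j p q assume ijpq: "i \<in> {..<n}" "j \<in> {..<n}" "p \<in> {..<k}" "q \<in> {..<k}"
      then have "?V $$ (p,q) = (if p = 0 then if q = 0 then v else 0 else 0)" by (simp add: compression_def)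
      moreover have "(F $$ (i,j)) 0 = 0" using ijpq lin by (intro linear_functionalD(3)) auto
      ultimately show "cnj (x i) * (F $$ (i,j)) (?V $$ (p,q)) * x j
          = (if p = 0 then if q = 0 then cnj (x i) * (F $$ (i,j)) v * x j else 0 else 0)" by simp
    qed
    also have "\<dots> = sesq n (\<lambda>i j. (F $$ (i,j)) v) x x" using k by (simp add: sesq_def sum_if_const)
    finally show "0 \<le> sesq n (\<lambda>i j. (F $$ (i,j)) v) x x" .
  qed (use lin in auto)
  have lin: "linear_functional S f" if "f \<in> dual_space S" for f using that by (simp add: dual_space_def linear_iff_linear_functional)
  show ?thesis
    unfolding Q_kmax_def dual_mats_def using form cont lin by auto
qed

text \<open>Both cones consist of matrices of linear functionals, so only the positivity
  conditions are compared. Every quadratic form in the description of \<open>Q_kmax\<close> is the value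
  at a compression, an element of \<open>C_kmax\<close>. Conversely a value on \<open>D_kmax\<close> is a sum of such
  quadratic forms, and positivity passes from \<open>D_kmax\<close> to \<open>C_kmax\<close> by letting \<open>r \<rightarrow> 0\<close>.\<close>

theorem dual_C_kmax:
  assumes k: "k \<ge> 1"
  shows "dual_cone S n (C_kmax S k n) = Q_kmax S k n"
proof -
  have sub: "C_kmax S k n \<subseteq> carrier_mat n n" by (auto simp: C_kmax_def)
  have "(\<forall>A\<in>C_kmax S k n. 0 \<le> pairing n F A) \<longleftrightarrow>
    (\<forall>V\<in>os_cone S k. \<forall>x. 0 \<le> block_form n k (\<lambda>i j p q. (F $$ (i,j)) (V $$ (p,q))) x)"
    if lin: "\<forall>i<n. \<forall>j<n. linear_functional S (F $$ (i,j))" for F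
  proof -
    have lin': "\<And>i j. i < n \<Longrightarrow> j < n \<Longrightarrow> linear_functional S (F $$ (i,j))" using lin by simp
    show ?thesis
    proof (intro iffI ballI allI)
      fix V x assume pos: "\<forall>A\<in>C_kmax S k n. 0 \<le> pairing n F A" and V: "V \<in> os_cone S k"
      show "0 \<le> block_form n k (\<lambda>i j p q. (F $$ (i,j)) (V $$ (p,q))) x"
        using bspec[OF pos compression_C_kmax[OF k V, of n "\<lambda>p i. x i p"]]
          pairing_compression[of n F, OF lin', where k = k and x = "\<lambda>p i. x i p" and V = V] by simp
    next
      fix A assume pos: "\<forall>V\<in>os_cone S k. \<forall>x. 0 \<le> block_form n k (\<lambda>i j p q. (F $$ (i,j)) (V $$ (p,q))) x"
        and A: "A \<in> C_kmax S k n"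
      have D: "0 \<le> pairing n F W" if W_in: "W \<in> D_kmax S k n" for W
      proof -
        obtain X Ds m where W: "W = bimod_prod (os_scale S) X (diag_block_mat Ds) (mat_adjoint X)"
          and X: "X \<in> carrier_mat n (m * k)" and Ds: "length Ds = m" "set Ds \<subseteq> os_cone S k"
          using W_in unfolding D_kmax_def by blast
        have "D \<in> carrier_mat k k" if "D \<in> set Ds" for D using that Ds cone_carrier[OF k] by blast
        moreover have "Ds ! l \<in> os_cone S k" if "l < m" for l using Ds that by auto
        ultimately show ?thesis
          unfolding W using pos by (subst pairing_D_kmax[OF lin' X Ds(1)]) (auto intro!: sum_nonneg)
      qed
      show "0 \<le> pairing n F A"
      proof (rule nonneg_if_perturbed_nonneg)
        fix r :: real assume r: "r > 0"
        have carr: "A \<in> carrier_mat n n" "unit_diag S n \<in> carrier_mat n n"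
          using A sub by (auto simp: unit_diag_def)
        have "0 \<le> pairing n F (scale_mat S (of_real r) (unit_diag S n) + A)"
          using A r by (intro D) (simp add: C_kmax_def)
        also have "\<dots> = pairing n F A + of_real r * pairing n F (unit_diag S n)"
        proof -
          have "scale_mat S (of_real r) (unit_diag S n) \<in> carrier_mat n n"
            using carr by (simp add: scale_mat_def)
          then show ?thesis
            using pairing_linear_on_mats[of n F, OF lin'] carr by (simp add: linear_on_mats_def)
        qed
        finally show "0 \<le> pairing n F A + of_real r * pairing n F (unit_diag S n)" .
      qed
    qed
  qed
  then show ?thesis unfolding set_eq_iff dual_cone_iff[OF sub] Q_kmax_iff[OF k] by blast
qed

end

theorem theorem5p7:
  fixes S :: "'a::ab_group_add opsys" and k n :: nat
  assumes "operator_system S" and "k \<ge> 1" and "n \<ge> 1"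
  shows "predual_cone n (Q_kmin S k n) = C_kmin S k n \<and>
         dual_cone S n (C_kmax S k n) = Q_kmax S k n"
  using operator_system.predual_Q_kmin[OF assms(1,2)] operator_system.dual_C_kmax[OF assms(1,2)] by blast

end
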